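(* Let $p\ge 2$ be an integer, let $\Bbbk$ be a field of characteristic zero containing a primitive $2p$-th root of unity $q$, and let $\overline{U}_q(sl_2)$ be the restricted quantum group over $\Bbbk$ with integral $\Lambda=F^{p-1}E^{p-1}\sum_{j=0}^{2p-1}K^{j}$. Then $$\chi_{\operatorname{reg}}(\Lambda^{\{2\}}) = 8p^4([p-1]!)^4.$$
   Context: $[n]=\frac{q^n-q^{-n}}{q-q^{-1}}$, $[n]!=[1][2]\cdots[n]$, $[0]!=1$. $\overline{U}_q(sl_2)$ is the Hopf algebra generated by $E,F,K$ with relations $E^p=F^p=0$, $K^{2p}=1$, $KEK^{-1}=q^2E$, $KFK^{-1}=q^{-2}F$, $[E,F]=EF-FE=\frac{K-K^{-1}}{q-q^{-1}}$; comultiplication $\Delta(E)=1\otimes E+E\otimes K$, $\Delta(F)=K^{-1}\otimes F+F\otimes 1$, $\Delta(K)=K\otimes K$; counit $\varepsilon(E)=\varepsilon(F)=0$, $\varepsilon(K)=1$; antipode $S(E)=-EK^{-1}$, $S(F)=-KF$, $S(K)=K^{-1}$. It has dimension $2p^3$ and is unimodular; $\Lambda$ is a two-sided integral. For a finite-dimensional unimodular Hopf algebra $H$ (Sweedler notation $\Delta(a)=a_1\otimes a_2$), let $\lambda$ be a nonzero right integral of $H^*$ ($\lambda(a_1)a_2=\lambda(a)1$ for all $a$) and let the distinguished group-like element $g$ be determined by $a_1\lambda(a_2)=\lambda(a)g$. The commutator is $\{a,b\}:=a_1S^2(b_1)S(a_2)S^{-1}(b_2)g^{-1}$, and $\Lambda^{\{2\}}:=\{\Lambda,\Lambda\}$.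 $\chi_{\operatorname{reg}}$ is the character of the left regular representation of $\overline{U}_q(sl_2)$. *)

theory Defs
  imports Complex_Main "HOL-Library.Poly_Mapping"
begin

section \<open>Tensors as formal sums\<close>

text \<open>
  An element of a tensor product is handled through a representing formal sum
  \<open>\<Sum>\<^sub>i a\<^sub>i \<otimes> b\<^sub>i\<close>, given as the list of the pairs \<open>(a\<^sub>i, b\<^sub>i)\<close> (triples for the
  threefold tensor product). Two formal sums represent the same tensor iff their difference in
  the free vector space on pairs (triples) lies in the span of the multilinearity relators, i.e.
  iff they agree in the usual quotient construction of the tensor product.
\<close>

definition fv_scale :: "'k::field \<Rightarrow> ('i \<Rightarrow>\<^sub>0 'k) \<Rightarrow> ('i \<Rightarrow>\<^sub>0 'k)" where
  "fv_scale c f = Poly_Mapping.map ((*) c) f"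

lemma lookup_fv_scale [simp]: "Poly_Mapping.lookup (fv_scale c f) i = c * Poly_Mapping.lookup f i"
  by (simp add: fv_scale_def Poly_Mapping.map.rep_eq when_def)

lemma vector_space_fv_scale: "vector_space fv_scale"
  by unfold_locales (auto intro!: poly_mapping_eqI simp: lookup_add algebra_simps)

definition formal_sum :: "'i list \<Rightarrow> ('i \<Rightarrow>\<^sub>0 'k::field)" where
  "formal_sum xs = (\<Sum>x\<leftarrow>xs. Poly_Mapping.single x 1)"

text \<open>\<open>slots\<close> is the set of maps that plug a vector into one slot of a pure tensor whose other
  entries are fixed.\<close>

definition multilinear_relators ::
    "('k::field \<Rightarrow> 'u::ab_group_add \<Rightarrow> 'u) \<Rightarrow> ('u \<Rightarrow> 'i) set \<Rightarrow> ('i \<Rightarrow>\<^sub>0 'k) set" where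
  "multilinear_relators smul slots =
     {Poly_Mapping.single (s (x + y)) 1 - Poly_Mapping.single (s x) 1 - Poly_Mapping.single (s y) 1
        | s x y. s \<in> slots}
     \<union> {Poly_Mapping.single (s (smul c x)) 1 - Poly_Mapping.single (s x) c | s c x. s \<in> slots}"

definition tensor_eq2 ::
    "('k::field \<Rightarrow> 'u::ab_group_add \<Rightarrow> 'u) \<Rightarrow> ('u \<times> 'u) list \<Rightarrow> ('u \<times> 'u) list \<Rightarrow> bool" where
  "tensor_eq2 smul xs ys \<longleftrightarrow>
     formal_sum xs - formal_sum ys \<in> module.span fv_scale
       (multilinear_relators smul ({\<lambda>x. (x, b) | b. True} \<union> {\<lambda>x. (a, x) | a. True}))"

definition tensor_eq3 ::
    "('k::field \<Rightarrow> 'u::ab_group_add \<Rightarrow> 'u) \<Rightarrow> ('u \<times> 'u \<times> 'u) list \<Rightarrow> ('u \<times> 'u \<times> 'u) list \<Rightarrow> bool" where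
  "tensor_eq3 smul xs ys \<longleftrightarrow>
     formal_sum xs - formal_sum ys \<in> module.span fv_scale
       (multilinear_relators smul
         ({\<lambda>x. (x, b, c) | b c. True} \<union> {\<lambda>x. (a, x, c) | a c. True} \<union> {\<lambda>x. (a, b, x) | a b. True}))"


section \<open>Hopf algebras\<close>

text \<open>
  \<open>comul a\<close> is an arbitrary choice of a formal sum \<open>a\<^sub>1 \<otimes> a\<^sub>2\<close> representing \<open>\<Delta>(a)\<close>, so the axioms
  on \<open>comul\<close> hold up to equality of tensors. A Sweedler expression that is multilinear in
  \<open>a\<^sub>1, a\<^sub>2\<close> is the sum of its values over the list \<open>comul a\<close>.
\<close>

locale hopf_algebra = vector_space smul
  for smul :: "'k::field \<Rightarrow> 'u::ring_1 \<Rightarrow> 'u" +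
  fixes comul :: "'u \<Rightarrow> ('u \<times> 'u) list"
    and counit :: "'u \<Rightarrow> 'k"
    and antipode :: "'u \<Rightarrow> 'u"
  assumes smul_mult_left: "smul c x * y = smul c (x * y)"
    and smul_mult_right: "x * smul c y = smul c (x * y)"
    and comul_add: "tensor_eq2 smul (comul (x + y)) (comul x @ comul y)"
    and comul_smul: "tensor_eq2 smul (comul (smul c x)) [(smul c a, b). (a, b) \<leftarrow> comul x]"
    and comul_mult:
      "tensor_eq2 smul (comul (x * y)) [(a * c, b * d). (a, b) \<leftarrow> comul x, (c, d) \<leftarrow> comul y]"
    and comul_one: "tensor_eq2 smul (comul 1) [(1, 1)]"
    and counit_linear: "Vector_Spaces.linear smul (*) counit"
    and counit_mult: "counit (x * y) = counit x * counit y"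
    and counit_one: "counit 1 = 1"
    and coassoc:
      "tensor_eq3 smul [(a1, a2, b). (a, b) \<leftarrow> comul x, (a1, a2) \<leftarrow> comul a]
                       [(a, b1, b2). (a, b) \<leftarrow> comul x, (b1, b2) \<leftarrow> comul b]"
    and counit_left: "(\<Sum>(a, b)\<leftarrow>comul x. smul (counit a) b) = x"
    and counit_right: "(\<Sum>(a, b)\<leftarrow>comul x. smul (counit b) a) = x"
    and antipode_linear: "Vector_Spaces.linear smul smul antipode"
    and antipode_left: "(\<Sum>(a, b)\<leftarrow>comul x. antipode a * b) = smul (counit x) 1"
    and antipode_right: "(\<Sum>(a, b)\<leftarrow>comul x. a * antipode b) = smul (counit x) 1"

definition right_integral ::
    "('k::field \<Rightarrow> 'u::ring_1 \<Rightarrow> 'u) \<Rightarrow> ('u \<Rightarrow> ('u \<times> 'u) list) \<Rightarrow> ('u \<Rightarrow> 'k) \<Rightarrow> bool" where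
  "right_integral smul comul lam \<longleftrightarrow>
     Vector_Spaces.linear smul (*) lam \<and>
     (\<forall>a. (\<Sum>(a1, a2)\<leftarrow>comul a. smul (lam a1) a2) = smul (lam a) 1)"

definition group_like ::
    "('k::field \<Rightarrow> 'u::ring_1 \<Rightarrow> 'u) \<Rightarrow> ('u \<Rightarrow> ('u \<times> 'u) list) \<Rightarrow> 'u \<Rightarrow> bool" where
  "group_like smul comul g \<longleftrightarrow> g \<noteq> 0 \<and> tensor_eq2 smul (comul g) [(g, g)]"

definition distinguished_group_like ::
    "('k::field \<Rightarrow> 'u::ring_1 \<Rightarrow> 'u) \<Rightarrow> ('u \<Rightarrow> ('u \<times> 'u) list) \<Rightarrow> ('u \<Rightarrow> 'k) \<Rightarrow> 'u \<Rightarrow> bool" where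
  "distinguished_group_like smul comul lam g \<longleftrightarrow>
     group_like smul comul g \<and>
     (\<forall>a. (\<Sum>(a1, a2)\<leftarrow>comul a. smul (lam a2) a1) = smul (lam a) g)"

definition mult_inverse :: "'u::ring_1 \<Rightarrow> 'u" where
  "mult_inverse x = (THE y. x * y = 1 \<and> y * x = 1)"

text \<open>The antipode of a finite-dimensional Hopf algebra is bijective, so \<open>inv antipode\<close> is its
  two-sided inverse there.\<close>

definition commutator ::
    "('u::ring_1 \<Rightarrow> ('u \<times> 'u) list) \<Rightarrow> ('u \<Rightarrow> 'u) \<Rightarrow> 'u \<Rightarrow> 'u \<Rightarrow> 'u \<Rightarrow> 'u" where
  "commutator comul antipode g a b =
     (\<Sum>(a1, a2)\<leftarrow>comul a. \<Sum>(b1, b2)\<leftarrow>comul b.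
        a1 * antipode (antipode b1) * antipode a2 * inv antipode b2 * mult_inverse g)"


section \<open>Trace and regular character\<close>

text \<open>The trace is computed from the diagonal matrix entries in some basis; it is only meaningful
  for finite-dimensional spaces.\<close>

definition lin_trace :: "('k::field \<Rightarrow> 'u::ab_group_add \<Rightarrow> 'u) \<Rightarrow> ('u \<Rightarrow> 'u) \<Rightarrow> 'k" where
  "lin_trace smul f =
     (let B = (SOME B. \<not> module.dependent smul B \<and> module.span smul B = UNIV)
      in \<Sum>b\<in>B. module.representation smul B (f b) b)"

definition regular_character :: "('k::field \<Rightarrow> 'u::ring_1 \<Rightarrow> 'u) \<Rightarrow> 'u \<Rightarrow> 'k" where
  "regular_character smul x = lin_trace smul (\<lambda>y. x * y)"


section \<open>Algebras given by generators and relations\<close>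

text \<open>With concatenation of words as addition of exponents, the convolution ring
  \<open>'g word \<Rightarrow>\<^sub>0 'k\<close> is the free associative algebra over \<open>'k\<close> on the generators \<open>'g\<close>.\<close>

datatype 'g word = Word (letters: "'g list")

instantiation word :: (type) monoid_add
begin

definition zero_word :: "'g word" where
  "zero_word = Word []"

definition plus_word :: "'g word \<Rightarrow> 'g word \<Rightarrow> 'g word" where
  "plus_word v w = Word (letters v @ letters w)"

instance
  by standard (auto simp: zero_word_def plus_word_def)

end

type_synonym ('g, 'k) free_algebra = "'g word \<Rightarrow>\<^sub>0 'k"

definition var :: "'g \<Rightarrow> ('g, 'k::field) free_algebra" where
  "var x = Poly_Mapping.single (Word [x]) 1"

definition scalar :: "'k \<Rightarrow> ('g, 'k::field) free_algebra" where
  "scalar c = Poly_Mapping.single 0 c"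

inductive_set two_sided_ideal :: "'r::ring_1 set \<Rightarrow> 'r set" for R where
  generator: "r \<in> R \<Longrightarrow> r \<in> two_sided_ideal R"
| zero: "0 \<in> two_sided_ideal R"
| add: "x \<in> two_sided_ideal R \<Longrightarrow> y \<in> two_sided_ideal R \<Longrightarrow> x + y \<in> two_sided_ideal R"
| mult_left: "x \<in> two_sided_ideal R \<Longrightarrow> a * x \<in> two_sided_ideal R"
| mult_right: "x \<in> two_sided_ideal R \<Longrightarrow> x * a \<in> two_sided_ideal R"

definition evaluate ::
    "('k::field \<Rightarrow> 'u::ring_1 \<Rightarrow> 'u) \<Rightarrow> ('g \<Rightarrow> 'u) \<Rightarrow> ('g, 'k) free_algebra \<Rightarrow> 'u" where
  "evaluate smul gen f =
     (\<Sum>w\<in>Poly_Mapping.keys f. smul (Poly_Mapping.lookup f w) (prod_list (map gen (letters w))))"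

text \<open>Evaluation at the generators induces an isomorphism from the quotient of the free algebra
  by the ideal generated by the relators.\<close>

definition presented_by ::
    "('k::field \<Rightarrow> 'u::ring_1 \<Rightarrow> 'u) \<Rightarrow> ('g \<Rightarrow> 'u) \<Rightarrow> ('g, 'k) free_algebra set \<Rightarrow> bool" where
  "presented_by smul gen R \<longleftrightarrow>
     surj (evaluate smul gen) \<and> {f. evaluate smul gen f = 0} = two_sided_ideal R"


section \<open>The restricted quantum group\<close>

definition primitive_root_of_unity :: "nat \<Rightarrow> 'k::field \<Rightarrow> bool" where
  "primitive_root_of_unity n q \<longleftrightarrow> n > 0 \<and> q ^ n = 1 \<and> (\<forall>m. 0 < m \<and> m < n \<longrightarrow> q ^ m \<noteq> 1)"

definition q_int :: "'k::field \<Rightarrow> nat \<Rightarrow> 'k" where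
  "q_int q n = (q ^ n - inverse q ^ n) / (q - inverse q)"

definition q_fact :: "'k::field \<Rightarrow> nat \<Rightarrow> 'k" where
  "q_fact q n = (\<Prod>i=1..n. q_int q i)"

datatype uq_gen = gE | gF | gK

text \<open>As \<open>K\<^sup>2\<^sup>p = 1\<close>, the inverse of \<open>K\<close> is written \<open>K\<^sup>2\<^sup>p\<^sup>-\<^sup>1\<close>.\<close>

definition uq_relators :: "nat \<Rightarrow> 'k::field \<Rightarrow> (uq_gen, 'k) free_algebra set" where
  "uq_relators p q =
     (let E = var gE; F = var gF; K = var gK; Kinv = K ^ (2 * p - 1) in
      {E ^ p, F ^ p, K ^ (2 * p) - 1,
       K * E * Kinv - scalar (q ^ 2) * E,
       K * F * Kinv - scalar (inverse q ^ 2) * F,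
       E * F - F * E - scalar (1 / (q - inverse q)) * (K - Kinv)})"

locale restricted_quantum_group = hopf_algebra smul comul counit antipode
  for smul :: "'k::field \<Rightarrow> 'u::ring_1 \<Rightarrow> 'u"
    and comul counit antipode +
  fixes p :: nat and q :: 'k and E F K :: 'u
  assumes presentation: "presented_by smul (case_uq_gen E F K) (uq_relators p q)"
    and comul_E: "tensor_eq2 smul (comul E) [(1, E), (E, K)]"
    and comul_F: "tensor_eq2 smul (comul F) [(K ^ (2 * p - 1), F), (F, 1)]"
    and comul_K: "tensor_eq2 smul (comul K) [(K, K)]"
    and counit_E: "counit E = 0"
    and counit_F: "counit F = 0"
    and counit_K: "counit K = 1"
    and antipode_E: "antipode E = - (E * K ^ (2 * p - 1))"
    and antipode_F: "antipode F = - (K * F)"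
    and antipode_K: "antipode K = K ^ (2 * p - 1)"

end

theory Submission
  imports Defs "HOL-Library.Function_Algebras" "HOL-Computational_Algebra.Polynomial"
begin

text \<open>
  Write \<open>\<Lambda>\<^sub>1 \<otimes> \<Lambda>\<^sub>2\<close> for \<open>\<Delta>(\<Lambda>)\<close>, and \<open>\<epsilon> a l\<close> for the scalar with \<open>E F\<^sup>l\<^sup>+\<^sup>1 v = \<epsilon> a l F\<^sup>l v\<close> when
  \<open>E v = 0\<close> and \<open>K v = a v\<close>. The idea is that the regular trace of \<open>\<Lambda>\<^sup>{\<^sup>2\<^sup>}\<close> only sees the two Steinberg
  modules, that is, the simple projective modules of dimension \<open>p\<close>, where the integral satisfies
  an orthogonality relation.

  As a left module over itself the algebra is filtered by Verma modules \<open>V\<^sub>a\<close> with basis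
  \<open>v, F v, \<dots>, F\<^sup>p\<^sup>-\<^sup>1 v\<close>, each highest weight \<open>a\<close> with \<open>a\<^sup>2\<^sup>p = 1\<close> occurring \<open>p\<close> times. Hence
  \<open>\<chi>\<^sub>r\<^sub>e\<^sub>g(x)\<close> is \<open>p\<close> times the sum over \<open>a\<close> of the traces of \<open>x\<close> on \<open>V\<^sub>a\<close> (regular_character_verma).

  The square of the antipode is conjugation by \<open>K\<close>, and \<open>g = K\<^sup>2\<close> (distinguished_group_like_eq).
  With the adjoint action \<open>ad x y = x\<^sub>1 y S(x\<^sub>2)\<close>, the commutator becomes
  \<open>ad \<Lambda> (K \<Lambda>\<^sub>1 K\<^sup>-\<^sup>1) K\<^sup>-\<^sup>1 S(\<Lambda>\<^sub>2) K\<^sup>-\<^sup>1\<close> (commutator_eq_ad). Since \<open>\<Lambda>\<close> absorbs \<open>K\<close> and is killed by \<open>F\<close>,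
  the element \<open>ad \<Lambda> y\<close> commutes with \<open>K\<close> and \<open>F\<close>, so it acts on \<open>V\<^sub>a\<close>, whose weights are distinct, by a
  scalar. Computing its lowest diagonal entry, with a Gauss product at a root of unity, gives the
  scalar \<open>C\<^sub>a \<Sum>\<^sub>s q\<^sup>-\<^sup>2\<^sup>s y\<^sub>s\<^sub>s\<close>, where \<open>C\<^sub>a = 2 p a\<^sup>1\<^sup>-\<^sup>p \<Prod>\<^sub>l \<epsilon> a l\<close> (verma_ad_integral).

  The product in \<open>C\<^sub>a\<close> is the scalar by which \<open>E\<^sup>p\<^sup>-\<^sup>1 F\<^sup>p\<^sup>-\<^sup>1\<close> acts on \<open>v\<close>. It vanishes unless \<open>a = \<plusminus>q\<^sup>-\<^sup>1\<close>, the
  highest weights of the Steinberg modules. For these two weights the elements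
  \<open>F\<^sup>i E\<^sup>p\<^sup>-\<^sup>1 F\<^sup>p\<^sup>-\<^sup>1\<^sup>-\<^sup>k\<close> act as nonzero multiples of the matrix units, so the formula for \<open>ad \<Lambda> y\<close> determines
  the matrix coefficients of \<open>\<Lambda>\<^sub>1 \<otimes> S(\<Lambda>\<^sub>2)\<close> (sweedler_integral_verma). Inserting them, the trace of the
  commutator on \<open>V\<^sub>a\<close> is \<open>p (C\<^sub>a / a)\<^sup>2\<close>, which is \<open>4 p\<^sup>3 ([p-1]!)\<^sup>4\<close> for both weights; two weights and the
  multiplicity \<open>p\<close> give the claim.

  All coordinates rest on the fact that the monomials \<open>F\<^sup>i E\<^sup>j K\<^sup>n\<close> are linearly independent, which uses that
  the relations are the only ones: the presented algebra acts on an explicit model of its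
  regular representation (regular_representation_exists).
\<close>

section \<open>Linear extension and multilinear maps on tensors\<close>

definition linear_extension ::
    "('k::field \<Rightarrow> 'w::ab_group_add \<Rightarrow> 'w) \<Rightarrow> ('i \<Rightarrow> 'w) \<Rightarrow> ('i \<Rightarrow>\<^sub>0 'k) \<Rightarrow> 'w" where
  "linear_extension s h f = (\<Sum>i\<in>Poly_Mapping.keys f. s (Poly_Mapping.lookup f i) (h i))"

context vector_space
begin

lemma linear_extension_superset:
  assumes "finite A" "Poly_Mapping.keys f \<subseteq> A"
  shows "linear_extension scale h f = (\<Sum>i\<in>A. scale (Poly_Mapping.lookup f i) (h i))"
  unfolding linear_extension_def using assms
  by (intro sum.mono_neutral_left) (auto simp: in_keys_iff)

lemma linear_extension_add:
  "linear_extension scale h (f + g) = linear_extension scale h f + linear_extension scale h g"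
proof -
  let ?A = "Poly_Mapping.keys f \<union> Poly_Mapping.keys g"
  have "Poly_Mapping.keys (f + g) \<subseteq> ?A"
    by (rule keys_add)
  then show ?thesis
    by (simp add: linear_extension_superset[where A = ?A] lookup_add scale_left_distrib sum.distrib)
qed

lemma linear_extension_zero [simp]: "linear_extension scale h 0 = 0"
  by (simp add: linear_extension_def)

lemma linear_extension_single [simp]:
  "linear_extension scale h (Poly_Mapping.single i c) = scale c (h i)"
  by (simp add: linear_extension_def)

lemma linear_extension_diff:
  "linear_extension scale h (f - g) = linear_extension scale h f - linear_extension scale h g"
  using linear_extension_add[of h "f - g" g] by (simp add: algebra_simps)

lemma linear_extension_fv_scale:
  "linear_extension scale h (fv_scale c f) = scale c (linear_extension scale h f)"
proof -
  have "Poly_Mapping.keys (fv_scale c f) \<subseteq> Poly_Mapping.keys f"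
    by (auto simp: in_keys_iff)
  then show ?thesis
    by (simp add: linear_extension_superset[where A = "Poly_Mapping.keys f"] scale_sum_right)
qed

lemma linear_extension_formal_sum:
  "linear_extension scale h (formal_sum xs) = (\<Sum>x\<leftarrow>xs. h x)"
  by (induction xs) (simp_all add: formal_sum_def linear_extension_add)

text \<open>A map on pure tensors that is linear in each slot kills the multilinearity relators, so its linear
  extension factors through the tensor product.\<close>

lemma linear_extension_span_relators:
  assumes slots: "\<And>s x y. s \<in> slots \<Longrightarrow> h (s (x + y)) = h (s x) + h (s y)"
    "\<And>s c x. s \<in> slots \<Longrightarrow> h (s (smul c x)) = scale c (h (s x))"
    and f: "f \<in> module.span fv_scale (multilinear_relators smul slots)"
  shows "linear_extension scale h f = 0"
proof -
  interpret fv: vector_space fv_scale by (rule vector_space_fv_scale)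
  show ?thesis
    using f
  proof (induction rule: fv.span_induct_alt)
    case base
    then show ?case by simp
  next
    case (step c r y)
    have "linear_extension scale h r = 0"
      using step(1) unfolding multilinear_relators_def
      by (auto simp: linear_extension_diff slots)
    with step show ?case
      by (simp add: linear_extension_add linear_extension_fv_scale)
  qed
qed

end

definition bilinear_map ::
    "('k::field \<Rightarrow> 'u::ab_group_add \<Rightarrow> 'u) \<Rightarrow> ('k \<Rightarrow> 'w::ab_group_add \<Rightarrow> 'w) \<Rightarrow> ('u \<Rightarrow> 'u \<Rightarrow> 'w) \<Rightarrow> bool" where
  "bilinear_map smul s B \<longleftrightarrow>
     (\<forall>x y b. B (x + y) b = B x b + B y b) \<and> (\<forall>c x b. B (smul c x) b = s c (B x b)) \<and>
     (\<forall>a x y. B a (x + y) = B a x + B a y) \<and> (\<forall>c a x. B a (smul c x) = s c (B a x))"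

lemma tensor_eq2_bilinear_map:
  assumes "vector_space s" and B: "bilinear_map smul s B" and eq: "tensor_eq2 smul xs ys"
  shows "(\<Sum>(a, b)\<leftarrow>xs. B a b) = (\<Sum>(a, b)\<leftarrow>ys. B a b)"
proof -
  interpret vector_space s by fact
  have "linear_extension s (\<lambda>(a, b). B a b) (formal_sum xs - formal_sum ys) = 0"
    by (rule linear_extension_span_relators[OF _ _ eq[unfolded tensor_eq2_def]])
       (use B in \<open>auto simp: bilinear_map_def\<close>)
  then show ?thesis
    by (simp add: linear_extension_diff linear_extension_formal_sum)
qed

lemma tensor_eq3_trilinear_map:
  assumes "vector_space s"
    and T: "\<And>c. bilinear_map smul s (\<lambda>a b. T a b c)" "\<And>a. bilinear_map smul s (T a)"
    and eq: "tensor_eq3 smul xs ys"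
  shows "(\<Sum>(a, b, c)\<leftarrow>xs. T a b c) = (\<Sum>(a, b, c)\<leftarrow>ys. T a b c)"
proof -
  interpret vector_space s by fact
  have "linear_extension s (\<lambda>(a, b, c). T a b c) (formal_sum xs - formal_sum ys) = 0"
    by (rule linear_extension_span_relators[OF _ _ eq[unfolded tensor_eq3_def]])
       (use T in \<open>auto simp: bilinear_map_def\<close>)
  then show ?thesis
    by (simp add: linear_extension_diff linear_extension_formal_sum)
qed

lemma vector_space_field: "vector_space ((*) :: 'k::field \<Rightarrow> 'k \<Rightarrow> 'k)"
  by unfold_locales (auto simp: algebra_simps)

section \<open>The trace from a coordinate expansion\<close>

text \<open>Expanding the image \<open>f b\<close> of a basis vector in the vectors \<open>e i\<close>, and each \<open>e i\<close> in the basis, turns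
  one diagonal sum into the other.\<close>

lemma (in vector_space) lin_trace_coordinates:
  assumes I: "finite I"
    and lin: "\<And>i. i \<in> I \<Longrightarrow> Vector_Spaces.linear scale (*) (\<phi> i)"
    and expand: "\<And>x. x = (\<Sum>i\<in>I. scale (\<phi> i x) (e i))"
    and f: "Vector_Spaces.linear scale scale f"
  shows "lin_trace scale f = (\<Sum>i\<in>I. \<phi> i (f (e i)))"
proof -
  define B where "B = (SOME B. \<not> dependent B \<and> span B = UNIV)"
  obtain B0 where "independent B0" "UNIV \<subseteq> span B0"
    using maximal_independent_subset[of UNIV] by blast
  then have "\<not> dependent B0 \<and> span B0 = UNIV" by auto
  then have B: "independent B" "span B = UNIV"
    unfolding B_def by (metis (mono_tags, lifting) someI_ex)+
  interpret f: Vector_Spaces.linear scale scale f by fact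
  have "B \<subseteq> span (e ` I)"
  proof
    fix x
    have "(\<Sum>i\<in>I. scale (\<phi> i x) (e i)) \<in> span (e ` I)"
      by (intro span_sum span_scale span_base) auto
    then show "x \<in> span (e ` I)"
      by (simp flip: expand)
  qed
  then have finB: "finite B"
    using independent_span_bound[of "e ` I" B] I B by auto
  have rep_sum: "representation B (\<Sum>i\<in>I. scale (c i) (v i)) b = (\<Sum>i\<in>I. c i * representation B (v i) b)" for c v b
    using B by (simp add: representation_sum representation_scale)
  have "lin_trace scale f = (\<Sum>b\<in>B. representation B (f b) b)"
    by (simp add: lin_trace_def B_def Let_def)
  also have "\<dots> = (\<Sum>b\<in>B. \<Sum>i\<in>I. \<phi> i (f b) * representation B (e i) b)"
    by (rule sum.cong[OF refl], subst expand, rule rep_sum)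
  also have "\<dots> = (\<Sum>i\<in>I. \<Sum>b\<in>B. \<phi> i (f b) * representation B (e i) b)"
    by (rule sum.swap)
  also have "\<dots> = (\<Sum>i\<in>I. \<phi> i (f (e i)))"
  proof (rule sum.cong[OF refl])
    fix i assume i: "i \<in> I"
    interpret ph: Vector_Spaces.linear scale "(*)" "\<phi> i" by (rule lin[OF i])
    have "\<phi> i (f (e i)) = \<phi> i (f (\<Sum>b\<in>B. scale (representation B (e i) b) b))"
      using B finB by (simp add: sum_representation_eq)
    also have "\<dots> = (\<Sum>b\<in>B. \<phi> i (f b) * representation B (e i) b)"
      by (simp add: f.sum f.scale ph.sum ph.scale mult.commute)
    finally show "(\<Sum>b\<in>B. \<phi> i (f b) * representation B (e i) b) = \<phi> i (f (e i))" ..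
  qed
  finally show ?thesis .
qed

section \<open>Modules over a presented algebra\<close>

text \<open>A family of operators indexed by the generators is a module over the free algebra: a word acts by
  composing its letters.\<close>

definition word_action ::
    "('k::field \<Rightarrow> 'v::ab_group_add \<Rightarrow> 'v) \<Rightarrow> ('g \<Rightarrow> 'v \<Rightarrow> 'v) \<Rightarrow> ('g, 'k) free_algebra \<Rightarrow> 'v \<Rightarrow> 'v" where
  "word_action s T f v = linear_extension s (\<lambda>w. foldr T (letters w) v) f"

lemma poly_mapping_single_induct [case_names zero add]:
  assumes "P 0" "\<And>f k v. P f \<Longrightarrow> P (f + Poly_Mapping.single k v)"
  shows "P f"
proof (induction f rule: update_induct)
  case const
  show ?case by (rule assms)
next
  case (update f a b)
  have "Poly_Mapping.update a b f = f + Poly_Mapping.single a b"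
    using update by (intro poly_mapping_eqI)
      (auto simp: lookup_update lookup_add lookup_single when_def in_keys_iff)
  then show ?case using assms(2) update by metis
qed

locale operator_family = vector_space scale
  for scale :: "'k::field \<Rightarrow> 'v::ab_group_add \<Rightarrow> 'v" +
  fixes T :: "'g \<Rightarrow> 'v \<Rightarrow> 'v"
  assumes T_linear: "Vector_Spaces.linear scale scale (T x)"
begin

abbreviation act where "act \<equiv> word_action scale T"

sublocale T: Vector_Spaces.linear scale scale "T x" for x
  by (rule T_linear)

lemma foldr_linear: "Vector_Spaces.linear scale scale (foldr T ws)"
proof (induction ws)
  case Nil
  show ?case by unfold_locales auto
next
  case (Cons w ws)
  interpret l: Vector_Spaces.linear scale scale "foldr T ws" by (rule Cons)
  show ?case
    by unfold_locales (auto simp: l.add l.scale T.add T.scale)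
qed

lemma act_vector_add: "act f (u + v) = act f u + act f v"
proof -
  have "foldr T ws (u + v) = foldr T ws u + foldr T ws v" for ws
    using foldr_linear by (simp add: Vector_Spaces.linear_iff)
  then show ?thesis
    by (simp add: word_action_def linear_extension_def scale_right_distrib sum.distrib)
qed

lemma act_vector_scale: "act f (scale c v) = scale c (act f v)"
proof -
  have "foldr T ws (scale c v) = scale c (foldr T ws v)" for ws
    using foldr_linear by (simp add: Vector_Spaces.linear_iff)
  then show ?thesis
    by (simp add: word_action_def linear_extension_def scale_sum_right mult.commute)
qed

lemma act_vector_zero [simp]: "act f 0 = 0"
  using act_vector_scale[of f 0 0] by simp

lemma act_add: "act (f + g) v = act f v + act g v"
  by (simp add: word_action_def linear_extension_add)

lemma act_diff: "act (f - g) v = act f v - act g v"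
  by (simp add: word_action_def linear_extension_diff)

lemma act_zero [simp]: "act 0 v = 0"
  by (simp add: word_action_def)

lemma act_single: "act (Poly_Mapping.single w c) v = scale c (foldr T (letters w) v)"
  by (simp add: word_action_def)

lemma act_var [simp]: "act (var x) v = T x v"
  by (simp add: var_def act_single)

lemma act_scalar [simp]: "act (scalar c) v = scale c v"
  by (simp add: scalar_def act_single zero_word_def)

lemma act_one [simp]: "act 1 v = v"
  using act_scalar[of 1 v] by (simp add: scalar_def)

lemma act_fv_scale: "act (fv_scale c f) v = scale c (act f v)"
  by (simp add: word_action_def linear_extension_fv_scale)

lemma act_single_mult:
  "act (Poly_Mapping.single w c * g) v = act (Poly_Mapping.single w c) (act g v)"
proof (induction g rule: poly_mapping_single_induct)
  case zero
  then show ?case by simp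
next
  case (add g u d)
  have "act (Poly_Mapping.single w c * Poly_Mapping.single u d) v
      = act (Poly_Mapping.single w c) (act (Poly_Mapping.single u d) v)"
    using foldr_linear[of "letters w"]
    by (simp add: mult_single act_single plus_word_def Vector_Spaces.linear_iff)
  then show ?case
    by (simp add: distrib_left act_add act_vector_add add)
qed

lemma act_mult: "act (f * g) v = act f (act g v)"
  by (induction f rule: poly_mapping_single_induct)
     (simp_all add: distrib_right act_add act_single_mult)

lemma act_power: "act (f ^ n) v = (act f ^^ n) v"
  by (induction n arbitrary: v) (simp_all add: act_mult)

end

lemma operator_family_left_mult:
  fixes smul :: "'k::field \<Rightarrow> 'u::ring_1 \<Rightarrow> 'u"
  assumes "vector_space smul" "\<And>c x y. x * smul c y = smul c (x * y)"
  shows "operator_family smul (\<lambda>x y. gen x * y)"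
  using assms
  by (simp add: operator_family_def operator_family_axioms_def Vector_Spaces.linear_iff distrib_left)

lemma evaluate_eq_word_action:
  "evaluate smul gen f = word_action smul (\<lambda>x y. gen x * y) f 1"
proof -
  have "foldr (\<lambda>x. (*) (gen x)) ws 1 = prod_list (map gen ws)" for ws
    by (induction ws) auto
  then show ?thesis
    by (simp add: evaluate_def word_action_def linear_extension_def)
qed

lemma presented_by_relator:
  assumes "presented_by smul gen R" "r \<in> R"
  shows "word_action smul (\<lambda>x y. gen x * y) r 1 = 0"
  using assms two_sided_ideal.generator[of r R]
  by (auto simp: presented_by_def simp flip: evaluate_eq_word_action)

text \<open>Operators that satisfy the relations on an invariant subspace \<open>S\<close> make \<open>S\<close> a module over the
  presented algebra; \<open>\<Phi>\<close> is the orbit map \<open>x \<mapsto> x v\<close>. It is well defined because an element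
  with value zero lies in the ideal of relations, which acts as zero on \<open>S\<close>.\<close>

lemma presented_algebra_acts:
  fixes smul :: "'k::field \<Rightarrow> 'u::ring_1 \<Rightarrow> 'u" and scale :: "'k \<Rightarrow> 'v::ab_group_add \<Rightarrow> 'v"
  assumes alg: "vector_space smul" "\<And>c x y. x * smul c y = smul c (x * y)"
    and pres: "presented_by smul gen R"
    and ops: "operator_family scale T"
    and S: "module.subspace scale S" "\<And>x v. v \<in> S \<Longrightarrow> T x v \<in> S" "v \<in> S"
    and relators: "\<And>r u. r \<in> R \<Longrightarrow> u \<in> S \<Longrightarrow> word_action scale T r u = 0"
  obtains \<Phi> where "Vector_Spaces.linear smul scale \<Phi>" "\<Phi> 1 = v"
    "\<And>x y. \<Phi> (gen x * y) = T x (\<Phi> y)" "\<And>y. \<Phi> y \<in> S"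
proof -
  interpret op: operator_family scale T by (rule ops)
  interpret reg: operator_family smul "\<lambda>x y. gen x * y"
    by (rule operator_family_left_mult[OF alg])
  note ev = evaluate_eq_word_action[of smul gen]
  have act_S: "op.act f u \<in> S" if "u \<in> S" for f u
  proof (induction f rule: poly_mapping_single_induct)
    case zero
    show ?case using S(1) by (simp add: op.subspace_0)
  next
    case (add f w c)
    have "foldr T ws u \<in> S" for ws
      by (induction ws) (use that S in auto)
    then show ?case
      using S(1) add by (simp add: op.act_add op.act_single op.subspace_add op.subspace_scale)
  qed
  have ideal: "\<forall>u\<in>S. op.act f u = 0" if "f \<in> two_sided_ideal R" for f
    using that
    by induction (auto simp: relators op.act_add op.act_mult act_S)
  have well_defined: "op.act f v = op.act g v" if "evaluate smul gen f = evaluate smul gen g" for f g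
  proof -
    have "evaluate smul gen (f - g) = 0"
      using that by (simp add: ev reg.act_diff)
    then have "f - g \<in> two_sided_ideal R"
      using pres by (auto simp: presented_by_def)
    then show ?thesis
      using ideal S(3) by (force simp: op.act_diff)
  qed
  define \<Phi> where "\<Phi> x = op.act (SOME f. evaluate smul gen f = x) v" for x
  have Phi: "\<Phi> (evaluate smul gen f) = op.act f v" for f
    unfolding \<Phi>_def by (rule well_defined) (rule someI_ex, auto)
  have surj: "\<exists>f. x = evaluate smul gen f" for x
    using pres by (auto simp: presented_by_def surj_def)
  show ?thesis
  proof
    show "Vector_Spaces.linear smul scale \<Phi>"
      unfolding Vector_Spaces.linear_iff
    proof (intro conjI allI)
      fix x y c
      obtain f g where x: "x = evaluate smul gen f" and y: "y = evaluate smul gen g"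
        using surj by metis
      show "\<Phi> (x + y) = \<Phi> x + \<Phi> y"
        using Phi[of "f + g"] Phi[of f] Phi[of g] by (simp add: x y ev reg.act_add op.act_add)
      show "\<Phi> (smul c x) = scale c (\<Phi> x)"
        using Phi[of "fv_scale c f"] Phi[of f] by (simp add: x ev reg.act_fv_scale op.act_fv_scale)
    qed (simp_all add: alg op.vector_space_axioms)
    show "\<Phi> 1 = v"
      using Phi[of 1] by (simp add: ev)
    show "\<Phi> (gen x * y) = T x (\<Phi> y)" for x y
    proof -
      obtain g where y: "y = evaluate smul gen g" using surj by metis
      show ?thesis
        using Phi[of "var x * g"] Phi[of g] by (simp add: y ev reg.act_mult op.act_mult)
    qed
    show "\<Phi> y \<in> S" for y
      using surj[of y] act_S S(3) by (auto simp: Phi)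
  qed
qed

text \<open>Evaluation is surjective, so the words in the generators span the algebra.\<close>

lemma presented_by_induct [consumes 3, case_names one gen add smul]:
  fixes smul :: "'k::field \<Rightarrow> 'u::ring_1 \<Rightarrow> 'u"
  assumes alg: "vector_space smul" "\<And>c x y. x * smul c y = smul c (x * y)"
    and pres: "presented_by smul gen R"
    and one: "P 1" and gen: "\<And>x y. P y \<Longrightarrow> P (gen x * y)"
    and add: "\<And>x y. P x \<Longrightarrow> P y \<Longrightarrow> P (x + y)" and smul: "\<And>c x. P x \<Longrightarrow> P (smul c x)"
  shows "P x"
proof -
  interpret vector_space smul by (rule alg)
  obtain f where x: "x = evaluate smul gen f"
    using pres by (auto simp: presented_by_def surj_def)
  have "P (linear_extension smul (\<lambda>w. prod_list (map gen (letters w))) f)"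
  proof (induction f rule: poly_mapping_single_induct)
    case zero
    show ?case using smul[OF one, of 0] by simp
  next
    case (add f w c)
    have "P (prod_list (map gen ws))" for ws
      by (induction ws) (auto intro: one gen)
    then show ?case
      by (simp add: linear_extension_add add smul assms(6))
  qed
  then show ?thesis
    by (simp add: x evaluate_def linear_extension_def)
qed

section \<open>Sweedler calculus in a Hopf algebra\<close>

lemma bilinear_mapI:
  assumes "\<And>x y b. B (x + y) b = B x b + B y b" "\<And>c x b. B (smul c x) b = s c (B x b)"
    "\<And>a x y. B a (x + y) = B a x + B a y" "\<And>c a x. B a (smul c x) = s c (B a x)"
  shows "bilinear_map smul s B"
  using assms by (simp add: bilinear_map_def)

lemma sum_list_map_additive:
  fixes f :: "'w::ab_group_add \<Rightarrow> 'v::ab_group_add"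
  assumes "\<And>x y. f (x + y) = f x + f y"
  shows "f (\<Sum>x\<leftarrow>xs. g x) = (\<Sum>x\<leftarrow>xs. f (g x))"
proof (induction xs)
  case Nil
  show ?case using assms[of 0 0] by simp
qed (simp add: assms)

lemma sum_list_swap:
  "(\<Sum>x\<leftarrow>xs. \<Sum>y\<leftarrow>ys. f x y) = (\<Sum>y\<leftarrow>ys. \<Sum>x\<leftarrow>xs. (f x y :: 'w::comm_monoid_add))"
  by (induction xs) (simp_all add: sum_list_addf)

lemma sum_list_sum_swap:
  "(\<Sum>x\<leftarrow>xs. \<Sum>y\<in>A. f x y) = (\<Sum>y\<in>A. \<Sum>x\<leftarrow>xs. (f x y :: 'w::comm_monoid_add))"
  by (induction xs) (simp_all add: sum.distrib)

context hopf_algebra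
begin

text \<open>\<open>sweedler x B\<close> is \<open>B x\<^sub>1 x\<^sub>2\<close> in Sweedler notation. For bilinear \<open>B\<close> it depends only on the tensor
  \<open>\<Delta>(x)\<close>, and then the Hopf axioms become equations between such values.\<close>

definition sweedler :: "'u \<Rightarrow> ('u \<Rightarrow> 'u \<Rightarrow> 'w::comm_monoid_add) \<Rightarrow> 'w" where
  "sweedler x B = (\<Sum>(a, b)\<leftarrow>comul x. B a b)"

lemma sweedler_distrib:
  "sweedler x (\<lambda>a b. B a b + C a b) = sweedler x B + sweedler x C"
  by (simp add: sweedler_def split_def sum_list_addf)

lemma sweedler_additive:
  fixes f :: "'w::ab_group_add \<Rightarrow> 'v::ab_group_add"
  assumes "\<And>x y. f (x + y) = f x + f y"
  shows "f (sweedler x B) = sweedler x (\<lambda>a b. f (B a b))"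
  unfolding sweedler_def split_def by (rule sum_list_map_additive) (rule assms)

lemma sweedler_swap:
  "sweedler x (\<lambda>a b. sweedler y (\<lambda>c d. B a b c d)) = sweedler y (\<lambda>c d. sweedler x (\<lambda>a b. B a b c d))"
  unfolding sweedler_def split_def by (rule sum_list_swap)

lemma sweedler_sum:
  "sweedler x (\<lambda>a b. \<Sum>i\<in>A. B i a b) = (\<Sum>i\<in>A. sweedler x (B i))"
  unfolding sweedler_def split_def by (rule sum_list_sum_swap)

lemma sweedler_mult_left: "y * sweedler x B = sweedler x (\<lambda>a b. y * (B a b :: 'r::ring))"
  by (rule sweedler_additive) (simp add: distrib_left)

lemma sweedler_mult_right: "sweedler x B * y = sweedler x (\<lambda>a b. (B a b :: 'r::ring) * y)"
  by (rule sweedler_additive[of "\<lambda>z. z * y"]) (simp add: distrib_right)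

lemma sweedler_smul: "smul c (sweedler x B) = sweedler x (\<lambda>a b. smul c (B a b))"
  by (rule sweedler_additive) (simp add: scale_right_distrib)

lemma sweedler_zero [simp]: "sweedler x (\<lambda>a b. 0) = 0"
  by (simp add: sweedler_def split_def)

lemma sweedler_tensor_eq:
  assumes "vector_space s" "bilinear_map smul s B" "tensor_eq2 smul (comul x) ys"
  shows "sweedler x B = (\<Sum>(a, b)\<leftarrow>ys. B a b)"
  unfolding sweedler_def by (rule tensor_eq2_bilinear_map) fact+

lemma sweedler_add:
  assumes "vector_space s" "bilinear_map smul s B"
  shows "sweedler (x + y) B = sweedler x B + sweedler y B"
  unfolding sweedler_tensor_eq[OF assms comul_add] by (simp add: sweedler_def)

lemma sweedler_scale:
  assumes s: "vector_space s" and B: "bilinear_map smul s B"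
  shows "sweedler (smul c x) B = s c (sweedler x B)"
proof -
  interpret s: vector_space s by fact
  have "(\<Sum>(a, b)\<leftarrow>[(smul c a, b). (a, b) \<leftarrow> comul x]. B a b) = (\<Sum>(a, b)\<leftarrow>comul x. s c (B a b))"
    using B by (simp add: bilinear_map_def split_def o_def)
  also have "\<dots> = s c (sweedler x B)"
    unfolding sweedler_def split_def by (rule sum_list_map_additive[symmetric]) (simp add: s.scale_right_distrib)
  finally show ?thesis
    by (simp add: sweedler_tensor_eq[OF assms comul_smul])
qed

lemma sum_list_product_tensor:
  "(\<Sum>(a, b)\<leftarrow>[(f a c, h b d). (a, b) \<leftarrow> xs, (c, d) \<leftarrow> ys]. B a b)
     = (\<Sum>(a, b)\<leftarrow>xs. \<Sum>(c, d)\<leftarrow>ys. B (f a c) (h b d))"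
  by (induction xs) (auto simp: split_def o_def)

lemma sweedler_mult:
  assumes "vector_space s" "bilinear_map smul s B"
  shows "sweedler (x * y) B = sweedler x (\<lambda>a b. sweedler y (\<lambda>c d. B (a * c) (b * d)))"
  unfolding sweedler_tensor_eq[OF assms comul_mult] sum_list_product_tensor by (simp add: sweedler_def)

lemma sweedler_one:
  assumes "vector_space s" "bilinear_map smul s B"
  shows "sweedler 1 B = B 1 1"
  unfolding sweedler_tensor_eq[OF assms comul_one] by simp

lemma sweedler_coassoc:
  assumes "vector_space s"
    and "\<And>c. bilinear_map smul s (\<lambda>a b. T a b c)" "\<And>a. bilinear_map smul s (T a)"
  shows "sweedler x (\<lambda>a b. sweedler a (\<lambda>a1 a2. T a1 a2 b)) = sweedler x (\<lambda>a b. sweedler b (T a))"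
proof -
  have left: "(\<Sum>(a, b, c)\<leftarrow>[(a1, a2, b). (a, b) \<leftarrow> xs, (a1, a2) \<leftarrow> comul a]. T a b c)
      = (\<Sum>(a, b)\<leftarrow>xs. \<Sum>(a1, a2)\<leftarrow>comul a. T a1 a2 b)" for xs
    by (induction xs) (auto simp: split_def o_def)
  have right: "(\<Sum>(a, b, c)\<leftarrow>[(a, b1, b2). (a, b) \<leftarrow> xs, (b1, b2) \<leftarrow> comul b]. T a b c)
      = (\<Sum>(a, b)\<leftarrow>xs. \<Sum>(b1, b2)\<leftarrow>comul b. T a b1 b2)" for xs
    by (induction xs) (auto simp: split_def o_def)
  show ?thesis
    using tensor_eq3_trilinear_map[OF assms coassoc[of x]] unfolding left right by (simp add: sweedler_def)
qed

lemmas smul_vs = vector_space_axioms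

lemma antipode_add [simp]: "antipode (x + y) = antipode x + antipode y"
  and antipode_smul [simp]: "antipode (smul c x) = smul c (antipode x)"
  using antipode_linear by (simp_all add: Vector_Spaces.linear_iff)

lemmas multilinear_simps = smul_mult_left smul_mult_right distrib_left distrib_right
  scale_right_distrib scale_left_distrib

lemma sweedler_counit_left: "sweedler x (\<lambda>a b. smul (counit a) b) = x"
  and sweedler_counit_right: "sweedler x (\<lambda>a b. smul (counit b) a) = x"
  and sweedler_antipode_left: "sweedler x (\<lambda>a b. antipode a * b) = smul (counit x) 1"
  and sweedler_antipode_right: "sweedler x (\<lambda>a b. a * antipode b) = smul (counit x) 1"
  using counit_left counit_right antipode_left antipode_right by (simp_all add: sweedler_def)

lemma antipode_one [simp]: "antipode 1 = 1"
proof -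
  have "bilinear_map smul smul (\<lambda>a b. antipode a * b)"
    by (rule bilinear_mapI) (simp_all add: multilinear_simps)
  from sweedler_one[OF smul_vs this] show ?thesis
    by (simp add: sweedler_antipode_left counit_one)
qed

text \<open>Both sides are convolution inverses of the multiplication map \<open>H \<otimes> H \<rightarrow> H\<close>: the expression
  \<open>S(x\<^sub>1 y\<^sub>1) x\<^sub>2 y\<^sub>2 S(y\<^sub>3) S(x\<^sub>3)\<close> collapses to either of them.\<close>

lemma antipode_mult: "antipode (x * y) = antipode y * antipode x"
proof -
  let ?S = antipode
  \<comment> \<open>\<open>a\<close>, \<open>b\<close> and \<open>e\<close> stand for the three Sweedler parts of \<open>x\<close>.\<close>
  have absorb_y: "sweedler y (\<lambda>y1 y2. sweedler y1 (\<lambda>c d. ?S (a * c) * (b * d) * (?S y2 * ?S e)))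
      = ?S (a * y) * b * ?S e" for a b e
  proof -
    have "sweedler y (\<lambda>y1 y2. sweedler y1 (\<lambda>c d. ?S (a * c) * (b * d) * (?S y2 * ?S e)))
        = sweedler y (\<lambda>y1 y2. sweedler y2 (\<lambda>c d. ?S (a * y1) * (b * c) * (?S d * ?S e)))"
      by (rule sweedler_coassoc[OF smul_vs]; rule bilinear_mapI) (simp_all add: multilinear_simps)
    also have "\<dots> = sweedler y (\<lambda>y1 y2. ?S (a * y1) * b * (sweedler y2 (\<lambda>c d. c * ?S d)) * ?S e)"
      by (simp add: sweedler_mult_left sweedler_mult_right mult.assoc)
    also have "\<dots> = sweedler y (\<lambda>y1 y2. ?S (a * smul (counit y2) y1) * b * ?S e)"
      by (simp add: sweedler_antipode_right multilinear_simps)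
    also have "\<dots> = ?S (a * sweedler y (\<lambda>y1 y2. smul (counit y2) y1)) * b * ?S e"
      by (rule sweedler_additive[symmetric]) (simp add: multilinear_simps)
    finally show ?thesis
      by (simp add: sweedler_counit_right)
  qed
  have "?S y * ?S x = ?S (sweedler y (\<lambda>y1 y2. smul (counit y1) y2)) * ?S (sweedler x (\<lambda>x1 x2. smul (counit x1) x2))"
    by (simp add: sweedler_counit_left)
  also have "\<dots> = sweedler y (\<lambda>y1 y2. ?S (smul (counit y1) y2) * ?S (sweedler x (\<lambda>x1 x2. smul (counit x1) x2)))"
    by (rule sweedler_additive) (simp add: multilinear_simps)
  also have "\<dots> = sweedler y (\<lambda>y1 y2. sweedler x (\<lambda>x1 x2. ?S (smul (counit y1) y2) * ?S (smul (counit x1) x2)))"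
    by (subst sweedler_additive[where f = "\<lambda>z. _ * ?S z"]) (simp_all add: multilinear_simps)
  also have "\<dots> = sweedler x (\<lambda>x1 x2. sweedler y (\<lambda>y1 y2. ?S (smul (counit y1) y2) * ?S (smul (counit x1) x2)))"
    by (rule sweedler_swap)
  also have "\<dots> = sweedler x (\<lambda>x1 x2. sweedler y (\<lambda>y1 y2. sweedler (x1 * y1) (\<lambda>a b. ?S a * b) * (?S y2 * ?S x2)))"
    by (simp add: sweedler_antipode_left counit_mult multilinear_simps)
  also have "\<dots> = sweedler x (\<lambda>x1 x2. sweedler y (\<lambda>y1 y2. sweedler x1 (\<lambda>a b. sweedler y1
      (\<lambda>c d. ?S (a * c) * (b * d) * (?S y2 * ?S x2)))))"
    by (subst sweedler_mult[OF smul_vs]) (auto intro!: bilinear_mapI simp: multilinear_simps sweedler_mult_right)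
  also have "\<dots> = sweedler x (\<lambda>x1 x2. sweedler x1 (\<lambda>a b. sweedler y (\<lambda>y1 y2. sweedler y1
      (\<lambda>c d. ?S (a * c) * (b * d) * (?S y2 * ?S x2)))))"
    by (subst sweedler_swap) (rule refl)
  also have "\<dots> = sweedler x (\<lambda>x1 x2. sweedler x1 (\<lambda>a b. ?S (a * y) * b * ?S x2))"
    by (simp add: absorb_y)
  also have "\<dots> = sweedler x (\<lambda>x1 x2. sweedler x2 (\<lambda>a b. ?S (x1 * y) * a * ?S b))"
    by (rule sweedler_coassoc[OF smul_vs]; rule bilinear_mapI) (simp_all add: multilinear_simps)
  also have "\<dots> = sweedler x (\<lambda>x1 x2. ?S (x1 * y) * sweedler x2 (\<lambda>a b. a * ?S b))"
    by (simp add: sweedler_mult_left mult.assoc)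
  also have "\<dots> = sweedler x (\<lambda>x1 x2. ?S (smul (counit x2) x1 * y))"
    by (simp add: sweedler_antipode_right multilinear_simps)
  also have "\<dots> = ?S (sweedler x (\<lambda>x1 x2. smul (counit x2) x1) * y)"
    by (rule sweedler_additive[symmetric]) (simp add: multilinear_simps)
  finally show ?thesis
    by (simp add: sweedler_counit_right)
qed

text \<open>The left adjoint action of the Hopf algebra on itself; anti-multiplicativity of the antipode makes it
  an action.\<close>

definition ad :: "'u \<Rightarrow> 'u \<Rightarrow> 'u" where
  "ad x y = sweedler x (\<lambda>a b. a * y * antipode b)"

lemma bilinear_ad: "bilinear_map smul smul (\<lambda>a b. a * y * antipode b)"
  by (rule bilinear_mapI) (simp_all add: multilinear_simps)

lemma ad_add_left: "ad (x + x') y = ad x y + ad x' y"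
  unfolding ad_def by (rule sweedler_add[OF smul_vs bilinear_ad])

lemma ad_one [simp]: "ad 1 y = y"
  unfolding ad_def by (simp add: sweedler_one[OF smul_vs bilinear_ad])

lemma ad_zero_left [simp]: "ad 0 y = 0"
  using ad_add_left[of 0 0 y] by simp

lemma ad_mult: "ad (x * x') y = ad x (ad x' y)"
  unfolding ad_def sweedler_mult[OF smul_vs bilinear_ad]
  by (simp add: antipode_mult sweedler_mult_left sweedler_mult_right mult.assoc)

lemma ad_power: "ad (x ^ n) = ad x ^^ n"
  by (induction n) (auto simp: fun_eq_iff ad_mult)

lemma ad_sum_left: "ad (\<Sum>i\<in>A. f i) y = (\<Sum>i\<in>A. ad (f i) y)"
  by (induction A rule: infinite_finite_induct) (simp_all add: ad_add_left)

end

section \<open>Roots of unity\<close>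

lemma geometric_sum_root_of_unity:
  fixes w :: "'k::field"
  assumes "w ^ n = 1" "w \<noteq> 1"
  shows "(\<Sum>i<n. w ^ i) = 0"
  using assms geometric_sum[of w n] by simp

locale even_root_of_unity =
  fixes p :: nat and q :: "'k::field_char_0"
  assumes p_ge_2: "2 \<le> p" and root: "primitive_root_of_unity (2 * p) q"
begin

lemma q_nonzero [simp]: "q \<noteq> 0"
  using root p_ge_2 by (auto simp: primitive_root_of_unity_def power_0_left)

lemma q_2p [simp]: "q ^ (2 * p) = 1"
  using root by (simp add: primitive_root_of_unity_def)

lemma q_power_neq_1: "0 < m \<Longrightarrow> m < 2 * p \<Longrightarrow> q ^ m \<noteq> 1"
  using root by (simp add: primitive_root_of_unity_def)

lemma q_power_p [simp]: "q ^ p = -1"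
proof -
  have "(q ^ p)\<^sup>2 = 1"
    using q_2p by (simp only: power_mult[symmetric] mult.commute)
  then show ?thesis
    using q_power_neq_1[of p] p_ge_2 by (simp add: power2_eq_1_iff)
qed

lemma q2_neq_1: "q ^ 2 \<noteq> 1"
  using q_power_neq_1[of 2] p_ge_2 by simp

lemma q_neq_inverse [simp]: "q \<noteq> inverse q"
  using q2_neq_1 by (auto simp: field_simps power2_eq_square)

lemma q_int_p [simp]: "q_int q p = 0"
  by (simp add: q_int_def power_inverse)

definition roots :: "'k set" where
  "roots = {a. a ^ (2 * p) = 1}"

lemma roots_nonzero: "a \<in> roots \<Longrightarrow> a \<noteq> 0"
  using p_ge_2 by (auto simp: roots_def power_0_left)

lemma roots_eq: "roots = (\<lambda>m. q ^ m) ` {..<2 * p}"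
  and inj_on_q_power: "inj_on (\<lambda>m. q ^ m) {..<2 * p}"
  and finite_roots [simp]: "finite roots"
  and card_roots: "card roots = 2 * p"
proof -
  have neq: "q ^ m \<noteq> q ^ n" if "m < n" "n < 2 * p" for m n
  proof
    assume "q ^ m = q ^ n"
    also have "q ^ n = q ^ m * q ^ (n - m)"
      using that by (simp flip: power_add)
    finally have "q ^ (n - m) = 1" by simp
    then show False using q_power_neq_1[of "n - m"] that by simp
  qed
  show inj: "inj_on (\<lambda>m. q ^ m) {..<2 * p}"
    by (rule linorder_inj_onI) (auto dest: neq)
  have fin: "finite roots" and card: "card roots \<le> 2 * p"
  proof -
    let ?P = "monom 1 (2 * p) - 1 :: 'k poly"
    have "degree (monom 1 (2 * p) + - 1 :: 'k poly) = degree (monom (1 :: 'k) (2 * p))"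
      using p_ge_2 by (intro degree_add_eq_left) (simp add: degree_monom_eq)
    then have deg: "degree ?P = 2 * p"
      by (simp add: degree_monom_eq)
    then have "?P \<noteq> 0" using p_ge_2 by force
    moreover have "roots = {a. poly ?P a = 0}"
      by (simp add: roots_def poly_monom)
    ultimately show "finite roots" "card roots \<le> 2 * p"
      using poly_roots_finite[of ?P] card_poly_roots_bound[of ?P] deg by simp_all
  qed
  have sub: "(\<lambda>m. q ^ m) ` {..<2 * p} \<subseteq> roots"
    by (auto simp: roots_def simp flip: power_mult) (metis mult.commute power_mult power_one q_2p)
  have "card ((\<lambda>m. q ^ m) ` {..<2 * p}) = 2 * p"
    using card_image[OF inj] by simp
  then show "roots = (\<lambda>m. q ^ m) ` {..<2 * p}" "finite roots" "card roots = 2 * p"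
    using card_subset_eq[OF fin sub] card card_mono[OF fin sub] fin by auto
qed

lemma one_in_roots [simp]: "1 \<in> roots" and q_in_roots [simp]: "q \<in> roots"
  by (simp_all add: roots_def)

lemma roots_mult [intro]: "a \<in> roots \<Longrightarrow> b \<in> roots \<Longrightarrow> a * b \<in> roots"
  and roots_inverse [intro]: "a \<in> roots \<Longrightarrow> inverse a \<in> roots"
  and roots_power [intro]: "a \<in> roots \<Longrightarrow> a ^ n \<in> roots"
  by (auto simp: roots_def power_mult_distrib power_inverse)
     (metis mult.commute power_mult power_one)

lemma roots_q_power [simp]: "q ^ n \<in> roots"
  by (rule roots_power) simp

lemma roots_power_inverse: "a \<in> roots \<Longrightarrow> a ^ (2 * p - 1) = inverse a"
proof -
  assume a: "a \<in> roots"
  have "a * a ^ (2 * p - 1) = 1"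
    using a p_ge_2 by (simp add: roots_def flip: power_Suc)
  then show ?thesis
    by (simp add: inverse_unique)
qed

lemma sum_roots_power: "n < 2 * p \<Longrightarrow> (\<Sum>a\<in>roots. a ^ n) = (if n = 0 then of_nat (2 * p) else 0)"
proof (cases "n = 0")
  case False
  assume n: "n < 2 * p"
  have "(\<Sum>a\<in>roots. a ^ n) = (\<Sum>m<2 * p. (q ^ n) ^ m)"
    unfolding roots_eq by (subst sum.reindex[OF inj_on_q_power]) (simp add: mult.commute flip: power_mult)
  also have "\<dots> = 0"
    using q_power_neq_1[of n] n False roots_q_power[of n]
    by (intro geometric_sum_root_of_unity) (simp_all add: roots_def)
  finally show ?thesis using False by simp
qed (simp add: card_roots)

lemma sum_roots_shift: "b \<in> roots \<Longrightarrow> (\<Sum>a\<in>roots. f (a * b)) = (\<Sum>a\<in>roots. f a)"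
  by (rule sum.reindex_bij_witness[of _ "\<lambda>a. a * inverse b" "\<lambda>a. a * b"]) (auto simp: roots_nonzero)

text \<open>The coefficient in \<open>E F\<^sup>i\<^sup>+\<^sup>1 v = eps a i F\<^sup>i v\<close> for a vector \<open>v\<close> of highest weight \<open>a\<close>.\<close>
definition eps :: "'k \<Rightarrow> nat \<Rightarrow> 'k" where
  "eps a i = q_int q (Suc i) * (a * inverse q ^ i - inverse a * q ^ i) / (q - inverse q)"

lemma eps_0: "eps a 0 = (a - inverse a) / (q - inverse q)"
  by (simp add: eps_def q_int_def)

lemma eps_last [simp]: "eps a (p - 1) = 0"
  using p_ge_2 by (simp add: eps_def)

text \<open>The commutator of \<open>E\<close> and \<open>F\<close> on a vector of weight \<open>a q\<^sup>-\<^sup>2\<^sup>(\<^sup>i\<^sup>+\<^sup>1\<^sup>)\<close>.\<close>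

lemma eps_Suc:
  "eps a (Suc i) - eps a i = (a * inverse q ^ (2 * Suc i) - inverse a * q ^ (2 * Suc i)) / (q - inverse q)"
proof -
  define d where "d = q - inverse q"
  define u v w b where "u = q ^ i" and "v = inverse q" and "w = inverse q ^ i" and "b = inverse a"
  have d: "d \<noteq> 0" unfolding d_def by (simp add: q_neq_inverse)
  have qv: "q * v = 1" and uw: "u * w = 1" and dv: "d = q - v"
    by (simp_all add: u_def v_def w_def d_def flip: power_mult_distrib)
  have id: "(q * (q * u) - v * (v * w)) * (a * (v * w) - b * (q * u)) - (q * u - v * w) * (a * w - b * u)
      = d * (a * (v * v * w * w) - b * (q * q * u * u))"
    using qv uw dv by algebra
  have "eps a (Suc i) - eps a i
      = ((q * (q * u) - v * (v * w)) * (a * (v * w) - b * (q * u)) - (q * u - v * w) * (a * w - b * u)) / (d * d)"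
    by (simp add: eps_def q_int_def u_def v_def w_def b_def d_def diff_divide_distrib[where c = "_ * _"])
  also have "\<dots> = (a * (v * v * w * w) - b * (q * q * u * u)) / d"
    unfolding id using d by (simp del: distrib_left distrib_right)
  also have "\<dots> = (a * inverse q ^ (2 * Suc i) - inverse a * q ^ (2 * Suc i)) / (q - inverse q)"
    unfolding power_even_eq
    by (simp add: u_def v_def w_def b_def d_def power2_eq_square mult_ac)
  finally show ?thesis .
qed

end

section \<open>The regular representation in weight coordinates\<close>

context even_root_of_unity
begin

text \<open>Weight of \<open>F\<^sup>i E\<^sup>j v\<close> for \<open>v\<close> of weight \<open>a\<close>.\<close>
definition weight :: "'k \<Rightarrow> nat \<Rightarrow> nat \<Rightarrow> 'k" where
  "weight a i j = a * q ^ (2 * j) * inverse q ^ (2 * i)"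

lemma weight_Suc_left: "weight a (Suc i) j = inverse q ^ 2 * weight a i j"
  and weight_Suc_right: "weight a i (Suc j) = q ^ 2 * weight a i j"
  by (simp_all add: weight_def power2_eq_square power_inverse)

lemma weight_roots: "a \<in> roots \<Longrightarrow> weight a i j \<in> roots"
  by (simp add: weight_def power_inverse roots_inverse roots_mult)

text \<open>The operators below model left multiplication by \<open>E\<close>, \<open>F\<close>, \<open>K\<close> on the span of the vectors \<open>F\<^sup>i E\<^sup>j v\<close>
  with \<open>i, j < p\<close> and \<open>K v = a v\<close>. A function on pairs \<open>(i, j)\<close> is a coefficient vector; the
  relations hold on the functions supported on this square.\<close>

definition supported :: "(nat \<times> nat \<Rightarrow> 'k) set" where
  "supported = {f. \<forall>i j. i \<ge> p \<or> j \<ge> p \<longrightarrow> f (i, j) = 0}"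

definition fun_scale :: "'k \<Rightarrow> (nat \<times> nat \<Rightarrow> 'k) \<Rightarrow> (nat \<times> nat \<Rightarrow> 'k)" where
  "fun_scale c f = (\<lambda>x. c * f x)"

definition opE :: "'k \<Rightarrow> (nat \<times> nat \<Rightarrow> 'k) \<Rightarrow> (nat \<times> nat \<Rightarrow> 'k)" where
  "opE a f = (\<lambda>(i, j). (if 0 < j \<and> j < p then f (i, j - 1) else 0) + eps (a * q ^ (2 * j)) i * f (Suc i, j))"

definition opF :: "(nat \<times> nat \<Rightarrow> 'k) \<Rightarrow> (nat \<times> nat \<Rightarrow> 'k)" where
  "opF f = (\<lambda>(i, j). if 0 < i \<and> i < p then f (i - 1, j) else 0)"

definition opK :: "'k \<Rightarrow> (nat \<times> nat \<Rightarrow> 'k) \<Rightarrow> (nat \<times> nat \<Rightarrow> 'k)" where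
  "opK a f = (\<lambda>(i, j). weight a i j * f (i, j))"

definition opKinv :: "'k \<Rightarrow> (nat \<times> nat \<Rightarrow> 'k) \<Rightarrow> (nat \<times> nat \<Rightarrow> 'k)" where
  "opKinv a f = (\<lambda>(i, j). inverse (weight a i j) * f (i, j))"

lemma vector_space_fun_scale: "vector_space fun_scale"
  by unfold_locales (auto simp: fun_scale_def fun_eq_iff algebra_simps)

lemma subspace_supported: "module.subspace fun_scale supported"
proof -
  interpret vector_space fun_scale by (rule vector_space_fun_scale)
  show ?thesis
    by (rule subspaceI) (auto simp: supported_def fun_scale_def)
qed

lemma operator_family_regular: "operator_family fun_scale (case_uq_gen (opE a) opF (opK a))"
  unfolding operator_family_def operator_family_axioms_def Vector_Spaces.linear_iff
  by (auto simp: vector_space_fun_scale fun_scale_def fun_eq_iff opE_def opF_def opK_def algebra_simps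
      split: uq_gen.split)

lemma opK_power: "(opK a ^^ n) f = (\<lambda>(i, j). weight a i j ^ n * f (i, j))"
  by (induction n) (auto simp: opK_def fun_eq_iff)

lemma opK_period:
  assumes "a \<in> roots"
  shows "(opK a ^^ (2 * p)) f = f" "(opK a ^^ (2 * p - 1)) f = opKinv a f"
  using weight_roots[OF assms] roots_power_inverse
  by (auto simp: opK_power opKinv_def fun_eq_iff) (simp add: roots_def)

lemma opE_supported: "f \<in> supported \<Longrightarrow> opE a f \<in> supported"
  and opF_supported: "f \<in> supported \<Longrightarrow> opF f \<in> supported"
  and opK_supported: "f \<in> supported \<Longrightarrow> opK a f \<in> supported"
  by (auto simp: supported_def opE_def opF_def opK_def)

lemma commutator_op:
  assumes a: "a \<in> roots" and f: "f \<in> supported"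
  shows "opE a (opF f) = opF (opE a f) + fun_scale (1 / (q - inverse q)) (opK a f - opKinv a f)"
proof (rule ext, clarify)
  fix i j
  let ?b = "a * q ^ (2 * j)"
  have b: "?b \<noteq> 0" using roots_nonzero[OF a] by simp
  have rhs: "fun_scale (1 / (q - inverse q)) (opK a f - opKinv a f) (i, j)
    = (?b * inverse q ^ (2 * i) - inverse ?b * q ^ (2 * i)) / (q - inverse q) * f (i, j)"
    by (simp add: fun_scale_def opK_def opKinv_def weight_def power_inverse diff_divide_distrib algebra_simps)
  show "opE a (opF f) (i, j) = (opF (opE a f) + fun_scale (1 / (q - inverse q)) (opK a f - opKinv a f)) (i, j)"
  proof (cases i)
    case 0
    then show ?thesis
      using p_ge_2 unfolding plus_fun_apply rhs
      by (simp add: opE_def opF_def eps_0 )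
  next
    case (Suc n)
    have step: "eps ?b i - eps ?b n = (?b * inverse q ^ (2 * i) - inverse ?b * q ^ (2 * i)) / (q - inverse q)"
      unfolding Suc by (rule eps_Suc)
    show ?thesis
    proof (cases "Suc i < p")
      case True
      then show ?thesis
        using Suc unfolding plus_fun_apply rhs step[symmetric]
        by (simp add: opE_def opF_def algebra_simps)
    next
      case False
      then have "i = p - 1 \<or> i \<ge> p" by auto
      then show ?thesis
      proof
        \<comment> \<open>In the last row \<open>F\<close> is cut off, which is harmless as \<open>[p] = 0\<close>.\<close>
        assume i: "i = p - 1"
        have "eps ?b i = 0" unfolding i by (rule eps_last)
        moreover have "\<not> Suc i < p" "i < p" using i p_ge_2 by simp_all
        ultimately show ?thesis
          using Suc unfolding plus_fun_apply rhs step[symmetric]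
          by (simp add: opE_def opF_def algebra_simps)
      next
        assume "i \<ge> p"
        then show ?thesis
          using f unfolding plus_fun_apply rhs
          by (simp add: opE_def opF_def supported_def)
      qed
    qed
  qed
qed

lemma opE_opK: "opK a (opE a f) = fun_scale (q ^ 2) (opE a (opK a f))"
proof (rule ext, clarify)
  fix i j
  have "weight a i j = q ^ 2 * weight a (Suc i) j"
    by (simp add: weight_Suc_left power_inverse)
  moreover have "weight a i j = q ^ 2 * weight a i (j - 1)" if "0 < j"
    using that weight_Suc_right[of a i "j - 1"] by simp
  ultimately show "opK a (opE a f) (i, j) = fun_scale (q ^ 2) (opE a (opK a f)) (i, j)"
    by (simp add: opK_def opE_def fun_scale_def distrib_left mult.left_commute)
qed

lemma opF_opK: "opK a (opF f) = fun_scale (inverse q ^ 2) (opF (opK a f))"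
  by (auto simp: opK_def opF_def fun_scale_def fun_eq_iff weight_Suc_left gr0_conv_Suc)

lemma opKinv_opE: "opKinv a (opE a f) = fun_scale (inverse q ^ 2) (opE a (opKinv a f))"
proof (rule ext, clarify)
  fix i j
  have "inverse (weight a i j) = inverse q ^ 2 * inverse (weight a (Suc i) j)"
    by (simp add: weight_Suc_left power_inverse)
  moreover have "inverse (weight a i j) = inverse q ^ 2 * inverse (weight a i (j - 1))" if "0 < j"
    using that weight_Suc_right[of a i "j - 1"] by (simp add: power_inverse)
  ultimately show "opKinv a (opE a f) (i, j) = fun_scale (inverse q ^ 2) (opE a (opKinv a f)) (i, j)"
    by (simp add: opKinv_def opE_def fun_scale_def distrib_left mult.left_commute)
qed

lemma op_linear:
  "opE a (f + g) = opE a f + opE a g" "opE a (f - g) = opE a f - opE a g"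
  "opE a (fun_scale c f) = fun_scale c (opE a f)"
  "opF (f + g) = opF f + opF g" "opF (fun_scale c f) = fun_scale c (opF f)"
  "fun_scale c (f + g) = fun_scale c f + fun_scale c g" "fun_scale c (f - g) = fun_scale c f - fun_scale c g"
  by (auto simp: opE_def opF_def fun_scale_def fun_eq_iff algebra_simps)

lemma fun_scale_mult: "fun_scale c (fun_scale d f) = fun_scale (c * d) f"
  by (simp add: fun_scale_def fun_eq_iff)

lemma opE_power_supported: "f \<in> supported \<Longrightarrow> (opE a ^^ n) f \<in> supported"
  by (induction n) (simp_all add: opE_supported)

lemma opK_opE_power: "opK a ((opE a ^^ n) f) = fun_scale ((q ^ 2) ^ n) ((opE a ^^ n) (opK a f))"
  and opKinv_opE_power: "opKinv a ((opE a ^^ n) f) = fun_scale ((inverse q ^ 2) ^ n) ((opE a ^^ n) (opKinv a f))"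
  by (induction n)
     (simp_all add: opE_opK opKinv_opE op_linear fun_scale_mult fun_scale_def[of 1])

text \<open>Moving \<open>F\<close> through \<open>E\<^sup>n\<^sup>+\<^sup>1\<close> collects one commutator per factor; the weights of the collected
  terms form geometric sums in \<open>q\<^sup>\<plusminus>\<^sup>2\<close>, which vanish for \<open>n + 1 = p\<close>.\<close>

lemma opE_power_opF:
  assumes a: "a \<in> roots" and f: "f \<in> supported"
  shows "(opE a ^^ Suc n) (opF f) = opF ((opE a ^^ Suc n) f)
    + fun_scale (1 / (q - inverse q)) (fun_scale (\<Sum>s<Suc n. (q ^ 2) ^ s) ((opE a ^^ n) (opK a f))
        - fun_scale (\<Sum>s<Suc n. (inverse q ^ 2) ^ s) ((opE a ^^ n) (opKinv a f)))"
proof (induction n)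
  case 0
  show ?case
    by (simp add: commutator_op[OF a f] fun_scale_def)
next
  case (Suc n)
  let ?D = "\<lambda>f. fun_scale (1 / (q - inverse q)) f"
  let ?e = "opE a ^^ Suc n"
  have "(opE a ^^ Suc (Suc n)) (opF f) = opE a (?e (opF f))"
    by simp
  also have "\<dots> = opE a (opF (?e f)) + ?D (fun_scale (\<Sum>s<Suc n. (q ^ 2) ^ s) (?e (opK a f))
      - fun_scale (\<Sum>s<Suc n. (inverse q ^ 2) ^ s) (?e (opKinv a f)))"
    unfolding Suc by (simp add: op_linear)
  also have "opE a (opF (?e f)) = opF (opE a (?e f)) + ?D (opK a (?e f) - opKinv a (?e f))"
    by (rule commutator_op[OF a opE_power_supported[OF f]])
  also have "opK a (?e f) - opKinv a (?e f)
      = fun_scale ((q ^ 2) ^ Suc n) (?e (opK a f)) - fun_scale ((inverse q ^ 2) ^ Suc n) (?e (opKinv a f))"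
    by (simp only: opK_opE_power opKinv_opE_power)
  finally show ?case
    unfolding sum.lessThan_Suc[where n = "Suc n"]
    by (auto simp: fun_scale_def fun_eq_iff algebra_simps simp del: sum.lessThan_Suc funpow.simps)
       (simp add: algebra_simps)
qed

text \<open>\<open>E\<^sup>p\<close> commutes with \<open>F\<close>, and it kills the vectors supported on \<open>i = 0\<close>, which \<open>E\<close> shifts in \<open>j\<close> only.
  Every supported vector is obtained from such vectors by applying \<open>F\<close> and adding.\<close>

lemma opE_nilpotent:
  assumes a: "a \<in> roots" and f: "f \<in> supported"
  shows "(opE a ^^ p) f = 0"
proof -
  have commute: "(opE a ^^ p) (opF g) = opF ((opE a ^^ p) g)" if g: "g \<in> supported" for g
  proof -
    have "(q ^ 2) ^ p = 1" "(inverse q ^ 2) ^ p = 1" "inverse q ^ 2 \<noteq> 1"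
      using q2_neq_1 q_2p by (simp_all only: power_inverse flip: power_mult) simp_all
    then have "(\<Sum>s<p. (q ^ 2) ^ s) = 0" "(\<Sum>s<p. (inverse q ^ 2) ^ s) = 0"
      using q2_neq_1 by (auto intro!: geometric_sum_root_of_unity simp del: power_inverse)
    moreover obtain n where "p = Suc n" using p_ge_2 by (cases p) auto
    ultimately show ?thesis
      using opE_power_opF[OF a g, of n] by (simp add: fun_scale_def fun_eq_iff)
  qed
  have top_row: "(opE a ^^ n) g = (\<lambda>(i, j). if n \<le> j \<and> j < p then g (i, j - n) else 0)"
    if g: "g \<in> supported" "\<And>i j. 0 < i \<Longrightarrow> g (i, j) = 0" for g n
  proof (induction n)
    case 0
    show ?case using g by (auto simp: supported_def fun_eq_iff)
  next
    case (Suc n)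
    then show ?case
      using g(2) by (auto simp: opE_def fun_eq_iff)
  qed
  have "\<forall>f \<in> supported. (\<forall>i j. n \<le> i \<longrightarrow> f (i, j) = 0) \<longrightarrow> (opE a ^^ p) f = 0" for n
  proof (induction n)
    case 0
    have "(opE a ^^ k) 0 = 0" for k
      by (induction k) (simp_all add: opE_def fun_eq_iff)
    moreover have "f = 0" if "\<forall>i j. 0 \<le> i \<longrightarrow> f (i, j) = 0" for f :: "nat \<times> nat \<Rightarrow> 'k"
      using that by (auto simp: fun_eq_iff)
    ultimately show ?case by blast
  next
    case (Suc n)
    show ?case
    proof (intro ballI impI)
      fix f assume f: "f \<in> supported" and vanish: "\<forall>i j. Suc n \<le> i \<longrightarrow> f (i, j) = 0"
      define f0 where "f0 = (\<lambda>(i, j). if i = 0 then f (i, j) else 0)"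
      define f1 where "f1 = (\<lambda>(i, j). f (Suc i, j))"
      have S: "f0 \<in> supported" "f1 \<in> supported"
        using f by (auto simp: f0_def f1_def supported_def)
      have split: "f = f0 + opF f1"
        using f by (auto simp: f0_def f1_def opF_def supported_def fun_eq_iff)
      have "(opE a ^^ p) f0 = 0"
        by (subst top_row) (use S in \<open>auto simp: f0_def fun_eq_iff\<close>)
      moreover have "(opE a ^^ p) f1 = 0"
        using Suc S vanish by (auto simp: f1_def)
      moreover have "(opE a ^^ k) (u + v) = (opE a ^^ k) u + (opE a ^^ k) v" for u v k
        by (induction k) (simp_all only: funpow.simps o_apply id_apply op_linear)
      ultimately show "(opE a ^^ p) f = 0"
        unfolding split by (simp add: commute S) (simp add: opF_def fun_eq_iff)
    qed
  qed
  from this[of p] show ?thesis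
    using f by (auto simp: supported_def)
qed

lemma opF_nilpotent: "(opF ^^ p) f = 0"
proof -
  have "(opF ^^ Suc n) f = (\<lambda>(i, j). if n < i \<and> i < p then f (i - Suc n, j) else 0)" for n
    by (induction n) (auto simp: opF_def fun_eq_iff)
  moreover obtain n where "p = Suc n" using p_ge_2 by (cases p) auto
  ultimately show ?thesis by (auto simp: fun_eq_iff)
qed

lemma regular_representation_relators:
  assumes a: "a \<in> roots" and f: "f \<in> supported" and r: "r \<in> uq_relators p q"
  shows "word_action fun_scale (case_uq_gen (opE a) opF (opK a)) r f = 0"
proof -
  interpret reg: operator_family fun_scale "case_uq_gen (opE a) opF (opK a)"
    by (rule operator_family_regular)
  have var: "reg.act (var x) = case_uq_gen (opE a) opF (opK a) x" for x
    by (rule ext) simp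
  note period = opK_period[OF a] opK_period[OF a, unfolded One_nat_def]
  have inverse: "opK a (opKinv a f) = f"
    using weight_roots[OF a] roots_nonzero by (auto simp: opK_def opKinv_def fun_eq_iff)
  show ?thesis
    using r f unfolding uq_relators_def Let_def
     by (auto simp: reg.act_mult reg.act_power reg.act_diff var opE_nilpotent[OF a] opF_nilpotent period
      opE_opK opF_opK inverse commutator_op[OF a])
qed

text \<open>\<open>\<Phi>\<close> lists the coefficients of \<open>x v\<close> in the vectors \<open>F\<^sup>i E\<^sup>j v\<close>.\<close>

lemma regular_representation_exists:
  fixes smul :: "'k \<Rightarrow> 'u::ring_1 \<Rightarrow> 'u"
  assumes alg: "vector_space smul" "\<And>c x y. x * smul c y = smul c (x * y)"
    and pres: "presented_by smul (case_uq_gen E F K) (uq_relators p q)" and a: "a \<in> roots"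
  shows "\<exists>\<Phi>. Vector_Spaces.linear smul fun_scale \<Phi> \<and> \<Phi> 1 = (\<lambda>x. if x = (0, 0) then 1 else 0) \<and>
    (\<forall>y. \<Phi> (E * y) = opE a (\<Phi> y) \<and> \<Phi> (F * y) = opF (\<Phi> y) \<and> \<Phi> (K * y) = opK a (\<Phi> y) \<and> \<Phi> y \<in> supported)"
proof -
  let ?v = "\<lambda>x. if x = (0, 0) then 1 else 0"
  let ?T = "case_uq_gen (opE a) opF (opK a)"
  have invariant: "?T x f \<in> supported" if "f \<in> supported" for x f
    using that by (cases x) (auto intro: opE_supported opF_supported opK_supported)
  have v: "?v \<in> supported"
    using p_ge_2 by (auto simp: supported_def)
  obtain \<Phi> where Phi: "Vector_Spaces.linear smul fun_scale \<Phi>" "\<Phi> 1 = ?v"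
    "\<And>x y. \<Phi> (case_uq_gen E F K x * y) = ?T x (\<Phi> y)" "\<And>y. \<Phi> y \<in> supported"
    by (rule presented_algebra_acts[OF alg pres operator_family_regular[of a] subspace_supported invariant v])
       (auto intro: regular_representation_relators[OF a])
  show ?thesis
    using Phi(1,2,4) Phi(3)[of gE] Phi(3)[of gF] Phi(3)[of gK] by (intro exI[of _ \<Phi>]) auto
qed

end

locale restricted_sl2 =
  restricted_quantum_group smul comul counit antipode p q E F K + even_root_of_unity p q
  for smul :: "'k::field_char_0 \<Rightarrow> 'u::ring_1 \<Rightarrow> 'u" and comul counit antipode p q E F K
begin

section \<open>Relations and spanning monomials\<close>

text \<open>\<open>K\<close> is invertible because \<open>K\<^sup>2\<^sup>p = 1\<close>; the name keeps the exponent out of calculations.\<close>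

definition Kinv :: 'u where "Kinv = K ^ (2 * p - 1)"

lemma funpow_times: "((*) (x :: 'u) ^^ n) y = x ^ n * y"
  by (induction n) (simp_all add: mult.assoc)

lemma defining_relations:
  shows E_power_p: "E ^ p = 0" and F_power_p: "F ^ p = 0" and K_power_2p: "K ^ (2 * p) = 1"
    and "K * E * Kinv = smul (q ^ 2) E" "K * F * Kinv = smul (inverse q ^ 2) F"
    and commutator_EF: "E * F = F * E + smul (1 / (q - inverse q)) (K - Kinv)"
proof -
  interpret reg: operator_family smul "\<lambda>x y. case_uq_gen E F K x * y"
    by (rule operator_family_left_mult[OF vector_space_axioms smul_mult_right])
  have var: "reg.act (var x) = (*) (case_uq_gen E F K x)" for x
    by (rule ext) simp
  have rel: "reg.act r 1 = 0" if "r \<in> uq_relators p q" for r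
    by (rule presented_by_relator[OF presentation that])
  note simps = Kinv_def var reg.act_mult reg.act_power reg.act_diff funpow_times mult.assoc
  note mem = uq_relators_def[of p q, unfolded Let_def]
  show "E ^ p = 0"
    using rel[of "var gE ^ p"] by (simp add: mem simps)
  show "F ^ p = 0"
    using rel[of "var gF ^ p"] by (simp add: mem simps)
  show "K ^ (2 * p) = 1"
    using rel[of "var gK ^ (2 * p) - 1"] by (simp add: mem simps)
  show "K * E * Kinv = smul (q ^ 2) E"
    using rel[of "var gK * var gE * var gK ^ (2 * p - 1) - scalar (q ^ 2) * var gE"]
    by (simp add: mem simps)
  show "K * F * Kinv = smul (inverse q ^ 2) F"
    using rel[of "var gK * var gF * var gK ^ (2 * p - 1) - scalar (inverse q ^ 2) * var gF"]
    by (simp add: mem simps)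
  have "E * F - F * E - smul (1 / (q - inverse q)) (K - Kinv) = 0"
    using rel[of "var gE * var gF - var gF * var gE - scalar (1 / (q - inverse q)) * (var gK - var gK ^ (2 * p - 1))"]
    by (simp add: mem simps)
  then show "E * F = F * E + smul (1 / (q - inverse q)) (K - Kinv)"
    by (simp add: diff_diff_eq)
qed

lemma K_Kinv: "K * Kinv = 1" and Kinv_K: "Kinv * K = 1"
  using K_power_2p p_ge_2 by (simp_all add: Kinv_def flip: power_Suc power_Suc2)

lemma K_Kinv_assoc: "K * (Kinv * x) = x" and Kinv_K_assoc: "Kinv * (K * x) = x"
  by (simp_all add: K_Kinv Kinv_K flip: mult.assoc)

lemma K_E: "K * E = smul (q ^ 2) (E * K)"
proof -
  have "K * E = K * E * Kinv * K" by (simp add: mult.assoc Kinv_K)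
  then show ?thesis by (simp add: defining_relations smul_mult_left)
qed

lemma K_F: "K * F = smul (inverse q ^ 2) (F * K)"
proof -
  have "K * F = K * F * Kinv * K" by (simp add: mult.assoc Kinv_K)
  then show ?thesis by (simp add: defining_relations smul_mult_left)
qed

lemma q_commute_power_right:
  assumes "x * y = smul c (y * x)"
  shows "x * y ^ n = smul (c ^ n) (y ^ n * x)"
proof (induction n)
  case (Suc n)
  have "x * y ^ Suc n = (x * y) * y ^ n" by (simp add: mult.assoc)
  also have "\<dots> = smul c (y * (x * y ^ n))" by (simp add: assms smul_mult_left mult.assoc)
  also have "\<dots> = smul (c ^ Suc n) (y ^ Suc n * x)"
    by (simp add: Suc smul_mult_right mult.assoc)
  finally show ?case .
qed simp

lemma q_commute_power_left:
  assumes "x * y = smul c (y * x)"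
  shows "x ^ n * y = smul (c ^ n) (y * x ^ n)"
proof (induction n)
  case (Suc n)
  have "x ^ Suc n * y = x * (x ^ n * y)" by (simp add: mult.assoc)
  also have "\<dots> = smul (c ^ n) ((x * y) * x ^ n)" by (simp add: Suc smul_mult_right mult.assoc)
  also have "\<dots> = smul (c ^ Suc n) (y * x ^ Suc n)"
    by (simp add: assms smul_mult_left mult.assoc mult.commute)
  finally show ?case .
qed simp

lemma K_E_power: "K ^ m * E ^ n = smul (q ^ (2 * m * n)) (E ^ n * K ^ m)"
  using q_commute_power_left[OF q_commute_power_right[OF K_E, of n], of m]
  by (simp add: mult.commute mult.left_commute flip: power_mult)

lemma K_F_power: "K ^ m * F ^ n = smul (inverse q ^ (2 * m * n)) (F ^ n * K ^ m)"
  using q_commute_power_left[OF q_commute_power_right[OF K_F, of n], of m]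
  by (simp add: mult.commute mult.left_commute flip: power_mult)

text \<open>Only the shape matters for spanning; the exact coefficients enter through the regular representation.\<close>

lemma E_F_power: "\<exists>c d. E * F ^ Suc n = F ^ Suc n * E + smul c (F ^ n * K) + smul d (F ^ n * Kinv)"
proof (induction n)
  case 0
  show ?case
    by (rule exI[of _ "1 / (q - inverse q)"], rule exI[of _ "- (1 / (q - inverse q))"])
       (simp add: commutator_EF scale_right_diff_distrib)
next
  case (Suc n)
  then obtain c d where IH: "E * F ^ Suc n = F ^ Suc n * E + smul c (F ^ n * K) + smul d (F ^ n * Kinv)"
    by blast
  let ?r = "1 / (q - inverse q)"
  have KF: "K * F ^ m = smul (inverse q ^ (2 * m)) (F ^ m * K)"
    and KinvF: "Kinv * F ^ m = smul (inverse q ^ (2 * (2 * p - 1) * m)) (F ^ m * Kinv)" for m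
    using K_F_power[of 1 m] K_F_power[of "2 * p - 1" m] by (simp_all add: Kinv_def)
  have "E * F ^ Suc (Suc n) = F * (E * F ^ Suc n) + smul ?r (K * F ^ Suc n - Kinv * F ^ Suc n)"
    unfolding power_Suc[of F "Suc n"] mult.assoc[symmetric] commutator_EF
    by (simp add: distrib_right smul_mult_left left_diff_distrib mult.assoc)
  also have "\<dots> = F ^ Suc (Suc n) * E + smul (c + ?r * inverse q ^ (2 * Suc n)) (F ^ Suc n * K)
      + smul (d - ?r * inverse q ^ (2 * (2 * p - 1) * Suc n)) (F ^ Suc n * Kinv)"
    unfolding IH KF KinvF
    by (simp add: distrib_left smul_mult_right scale_left_distrib scale_left_diff_distrib
        scale_right_diff_distrib mult.assoc)
  finally show ?case by blast
qed

lemma algebra_induct [case_names one E F K add smul]: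
  assumes "P 1" "\<And>y. P y \<Longrightarrow> P (E * y)" "\<And>y. P y \<Longrightarrow> P (F * y)" "\<And>y. P y \<Longrightarrow> P (K * y)"
    "\<And>x y. P x \<Longrightarrow> P y \<Longrightarrow> P (x + y)" "\<And>c x. P x \<Longrightarrow> P (smul c x)"
  shows "P x"
proof (rule presented_by_induct[OF vector_space_axioms smul_mult_right presentation])
  fix g y assume "P y"
  then show "P (case_uq_gen E F K g * y)"
    using assms by (cases g) auto
qed (use assms in auto)

definition monomials :: "'u set" where
  "monomials = {F ^ i * E ^ j * K ^ n | i j n. i < p \<and> j < p}"

lemma monomial_in_span:
  "F ^ i * E ^ j * K ^ n \<in> span monomials"
proof (cases "i < p \<and> j < p")
  case True
  then show ?thesis by (intro span_base) (auto simp: monomials_def)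
next
  case False
  then have "F ^ i = 0 \<or> E ^ j = 0"
    using E_power_p F_power_p power_add[of F p "i - p"] power_add[of E p "j - p"] by auto
  then show ?thesis by (auto simp: span_zero)
qed

lemma F_K_E_in_span: "F ^ i * K ^ m * E ^ j * K ^ n \<in> span monomials"
proof -
  have "F ^ i * K ^ m * E ^ j * K ^ n = smul (q ^ (2 * m * j)) (F ^ i * E ^ j * K ^ (m + n))"
    using K_E_power[of m j] by (simp add: mult.assoc power_add smul_mult_right smul_mult_left
        flip: mult.assoc[of "K ^ m" "E ^ j"])
  then show ?thesis by (simp add: span_scale monomial_in_span)
qed

lemma span_monomials: "x \<in> span monomials"
proof -
  have closed: "g * y \<in> span monomials"
    if g: "\<And>i j n. g * (F ^ i * E ^ j * K ^ n) \<in> span monomials" and y: "y \<in> span monomials" for g y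
    using y
  proof (induction rule: span_induct_alt)
    case base
    show ?case by (simp add: span_zero)
  next
    case (step c m y)
    have "g * m \<in> span monomials"
      using step(1) g by (auto simp: monomials_def)
    with step show ?case
      by (simp add: distrib_left smul_mult_right span_add span_scale)
  qed
  show ?thesis
  proof (induction x rule: algebra_induct)
    case one
    show ?case using monomial_in_span[of 0 0 0] by simp
  next
    case (E y)
    have "E * (F ^ i * E ^ j * K ^ n) \<in> span monomials" for i j n
    proof (cases i)
      case 0
      then show ?thesis
        using monomial_in_span[of 0 "Suc j" n] by (simp add: mult.assoc)
    next
      case (Suc m)
      obtain c d where cd: "E * F ^ Suc m = F ^ Suc m * E + smul c (F ^ m * K) + smul d (F ^ m * Kinv)"
        using E_F_power by blast
      have "E * (F ^ i * E ^ j * K ^ n) = (E * F ^ Suc m) * E ^ j * K ^ n"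
        by (simp add: Suc mult.assoc)
      also have "\<dots> = F ^ Suc m * E ^ Suc j * K ^ n + smul c (F ^ m * K ^ 1 * E ^ j * K ^ n)
          + smul d (F ^ m * K ^ (2 * p - 1) * E ^ j * K ^ n)"
        unfolding cd Kinv_def by (simp add: distrib_right smul_mult_left mult.assoc)
      finally show ?thesis
        by (simp only:) (intro span_add span_scale monomial_in_span F_K_E_in_span)
    qed
    then show ?case by (rule closed) fact
  next
    case (F y)
    have "F * (F ^ i * E ^ j * K ^ n) \<in> span monomials" for i j n
      using monomial_in_span[of "Suc i" j n] by (simp add: mult.assoc)
    then show ?case by (rule closed) fact
  next
    case (K y)
    have "K * (F ^ i * E ^ j * K ^ n) \<in> span monomials" for i j n
    proof -
      have "K * (F ^ i * E ^ j * K ^ n) = (K ^ 1 * F ^ i) * E ^ j * K ^ n"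
        by (simp add: mult.assoc)
      also have "\<dots> = smul (inverse q ^ (2 * 1 * i)) (F ^ i * K ^ 1 * E ^ j * K ^ n)"
        unfolding K_F_power by (simp add: smul_mult_left)
      finally show ?thesis
        using F_K_E_in_span[of i 1 j n] by (simp add: span_scale)
    qed
    then show ?case by (rule closed) fact
  qed (auto intro: span_add span_scale)
qed

lemma monomial_induct [case_names monomial add smul]:
  assumes "\<And>i j n. i < p \<Longrightarrow> j < p \<Longrightarrow> P (F ^ i * E ^ j * K ^ n)"
    "\<And>x y. P x \<Longrightarrow> P y \<Longrightarrow> P (x + y)" "\<And>c x. P x \<Longrightarrow> P (smul c x)"
  shows "P x"
  using span_monomials[of x]
proof (induction rule: span_induct_alt)
  case base
  show ?case using assms(3)[OF assms(1)[of 0 0 0], of 0] p_ge_2 by simp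
next
  case (step c m y)
  then show ?case using assms by (auto simp: monomials_def)
qed

section \<open>PBW coordinates\<close>

definition regular_coordinates :: "'k \<Rightarrow> ('u \<Rightarrow> nat \<times> nat \<Rightarrow> 'k) \<Rightarrow> bool" where
  "regular_coordinates a \<Phi> \<longleftrightarrow>
     Vector_Spaces.linear smul fun_scale \<Phi> \<and> \<Phi> 1 = (\<lambda>x. if x = (0, 0) then 1 else 0) \<and>
     (\<forall>y. \<Phi> (E * y) = opE a (\<Phi> y) \<and> \<Phi> (F * y) = opF (\<Phi> y) \<and> \<Phi> (K * y) = opK a (\<Phi> y) \<and> \<Phi> y \<in> supported)"

text \<open>For \<open>a\<^sup>2\<^sup>p = 1\<close>, \<open>coord a x i j\<close> is the coefficient of \<open>F\<^sup>i E\<^sup>j v\<close> in \<open>x v\<close>, where \<open>v\<close> is the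
  idempotent of weight \<open>a\<close> in the algebra generated by \<open>K\<close>. For other \<open>a\<close> the value is meaningless.\<close>

definition coord :: "'k \<Rightarrow> 'u \<Rightarrow> nat \<Rightarrow> nat \<Rightarrow> 'k" where
  "coord a x i j = (SOME \<Phi>. regular_coordinates a \<Phi>) x (i, j)"

lemma regular_coordinates_exist:
  "a \<in> roots \<Longrightarrow> regular_coordinates a (SOME \<Phi>. regular_coordinates a \<Phi>)"
  using regular_representation_exists[OF vector_space_axioms smul_mult_right presentation]
  unfolding regular_coordinates_def by (rule someI_ex)

context
  fixes a :: 'k
  assumes a: "a \<in> roots"
begin

lemma coord_add [simp]: "coord a (x + y) i j = coord a x i j + coord a y i j"
  and coord_smul [simp]: "coord a (smul c x) i j = c * coord a x i j"
  and coord_one: "coord a 1 i j = (if i = 0 \<and> j = 0 then 1 else 0)"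
  and coord_E: "coord a (E * x) i j = (if 0 < j \<and> j < p then coord a x i (j - 1) else 0)
      + eps (a * q ^ (2 * j)) i * coord a x (Suc i) j"
  and coord_F: "coord a (F * x) i j = (if 0 < i \<and> i < p then coord a x (i - 1) j else 0)"
  and coord_K: "coord a (K * x) i j = weight a i j * coord a x i j"
  and coord_out: "i \<ge> p \<or> j \<ge> p \<Longrightarrow> coord a x i j = 0"
  using regular_coordinates_exist[OF a]
  by (auto simp: regular_coordinates_def coord_def Vector_Spaces.linear_iff fun_scale_def opE_def opF_def opK_def supported_def)

lemma coord_zero [simp]: "coord a 0 i j = 0"
  using coord_smul[of 0 0 i j] by simp

lemma coord_diff [simp]: "coord a (x - y) i j = coord a x i j - coord a y i j"
  using coord_add[of "x - y" y i j] by simp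

lemma coord_sum [simp]: "coord a (\<Sum>x\<in>A. f x) i j = (\<Sum>x\<in>A. coord a (f x) i j)"
  by (induction A rule: infinite_finite_induct) simp_all

lemma coord_mult_K: "coord a (x * K) i j = a * coord a x i j"
proof (induction x arbitrary: i j rule: algebra_induct)
  case one
  show ?case using coord_K[of 1 i j] by (simp add: coord_one weight_def)
qed (simp_all add: coord_E coord_F coord_K smul_mult_left distrib_right mult.assoc distrib_left mult.left_commute)

lemma coord_mult_K_power: "coord a (x * K ^ n) i j = a ^ n * coord a x i j"
  by (induction n arbitrary: x) (simp_all add: coord_mult_K mult_ac flip: mult.assoc)

lemma coord_F_power: "coord a (F ^ n * x) i j = (if n \<le> i \<and> i < p then coord a x (i - n) j else 0)"
  by (induction n arbitrary: i) (auto simp: coord_out mult.assoc coord_F)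

end

text \<open>If \<open>v\<close> has weight \<open>a\<close>, then \<open>E v\<close> has weight \<open>a q\<^sup>2\<close>, so right multiplication by \<open>E\<close> shifts \<open>j\<close> and
  changes the reference weight.\<close>

lemma coord_mult_E:
  assumes a: "a \<in> roots"
  shows "coord a (x * E) i j = (if 0 < j \<and> j < p then coord (a * q ^ 2) x i (j - 1) else 0)"
proof (induction x arbitrary: i j rule: algebra_induct)
  have a': "a * q ^ 2 \<in> roots" by (intro roots_mult a) simp
  note coords = coord_E[OF a] coord_F[OF a] coord_K[OF a] coord_E[OF a'] coord_F[OF a'] coord_K[OF a']
  {
    case one
    show ?case using coord_E[OF a, of 1] by (simp add: coord_one[OF a] coord_one[OF a'])
  next
    case (E y)
    have "a * q ^ 2 * q ^ (2 * (j - 1)) = a * q ^ (2 * j)" if "0 < j"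
      using that by (cases j) (simp_all add: power2_eq_square mult_ac)
    with E show ?case
      by (auto simp: mult.assoc coords)
  next
    case (F y)
    then show ?case
      by (auto simp: mult.assoc coords)
  next
    case (K y)
    have "weight (a * q ^ 2) i (j - 1) = weight a i j" if "0 < j"
      using that by (cases j) (simp_all add: weight_def power2_eq_square mult_ac)
    with K show ?case
      by (auto simp: mult.assoc coords)
  next
    case (add x y)
    then show ?case
      using a a' by (simp add: distrib_right)
  next
    case (smul c x)
    then show ?case
      using a a' by (simp add: smul_mult_left)
  }
qed

lemma coord_mult_E_power:
  "a \<in> roots \<Longrightarrow> coord a (x * E ^ n) i j = (if n \<le> j \<and> j < p then coord (a * q ^ (2 * n)) x i (j - n) else 0)"
proof (induction n arbitrary: a j)
  case 0
  then show ?case by (auto simp: coord_out)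
next
  case (Suc n)
  have a': "a * q ^ 2 \<in> roots" by (intro roots_mult Suc) simp
  have *: "a * q ^ 2 * q ^ (2 * n) = a * q ^ (2 * Suc n)"
    by (simp add: power2_eq_square)
  have "coord a (x * E ^ Suc n) i j = coord a (x * E ^ n * E) i j"
    by (simp add: mult.assoc power_commutes)
  also have "\<dots> = (if Suc n \<le> j \<and> j < p then coord (a * q ^ (2 * Suc n)) x i (j - Suc n) else 0)"
    unfolding coord_mult_E[OF Suc.prems] Suc.IH[OF a'] * by auto
  finally show ?case .
qed

lemma coord_monomial:
  assumes "a \<in> roots" "i < p" "j < p"
  shows "coord a (F ^ i * E ^ j * K ^ n) i' j' = (if i' = i \<and> j' = j then a ^ n else 0)"
proof -
  have "a * q ^ (2 * j) \<in> roots"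
    using assms by (intro roots_mult) simp_all
  then have "coord a (1 * E ^ j) i j' = (if i = 0 \<and> j' = j then 1 else 0)" for i
    using assms by (auto simp: coord_mult_E_power coord_one simp del: mult_1_left)
  then show ?thesis
    using assms by (auto simp: coord_mult_K_power coord_F_power)
qed

definition weight_idempotent :: "'k \<Rightarrow> 'u" where
  "weight_idempotent a = smul (1 / of_nat (2 * p)) (\<Sum>n<2 * p. smul (inverse a ^ n) (K ^ n))"

lemma K_weight_idempotent: "a \<in> roots \<Longrightarrow> K * weight_idempotent a = smul a (weight_idempotent a)"
proof -
  assume a: "a \<in> roots"
  let ?f = "\<lambda>n. smul (inverse a ^ n) (K ^ n)"
  have "inverse a \<in> roots" using a by (rule roots_inverse)
  then have "(\<Sum>n<2 * p. ?f (Suc n)) = (\<Sum>n<2 * p. ?f n)"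
    using sum.lessThan_Suc_shift[of ?f "2 * p"] sum.lessThan_Suc[of ?f "2 * p"]
    by (simp add: K_power_2p roots_def)
  moreover have "K * ?f n = smul a (?f (Suc n))" for n
    using roots_nonzero[OF a] by (simp add: smul_mult_right)
  then have "K * (\<Sum>n<2 * p. ?f n) = smul a (\<Sum>n<2 * p. ?f (Suc n))"
    by (simp only: sum_distrib_left scale_sum_right)
  ultimately show ?thesis
    unfolding weight_idempotent_def smul_mult_right
    by (metis scale_left_commute)
qed

lemma sum_weight_idempotent: "(\<Sum>a\<in>roots. weight_idempotent a) = 1"
proof -
  have "(\<Sum>a\<in>roots. inverse a ^ n) = (\<Sum>a\<in>roots. a ^ n)" for n
    by (rule sum.reindex_bij_witness[of _ inverse inverse]) auto
  then have coeff: "(\<Sum>a\<in>roots. inverse a ^ n) = (if n = 0 then of_nat (2 * p) else 0)" if "n < 2 * p" for n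
    using sum_roots_power[OF that] by simp
  have "(\<Sum>a\<in>roots. \<Sum>n<2 * p. smul (inverse a ^ n) (K ^ n)) = (\<Sum>n<2 * p. smul (\<Sum>a\<in>roots. inverse a ^ n) (K ^ n))"
    by (subst sum.swap) (simp add: scale_sum_left)
  also have "\<dots> = (\<Sum>n<2 * p. if n = 0 then smul (of_nat (2 * p)) 1 else 0)"
    by (rule sum.cong) (auto simp: coeff)
  also have "\<dots> = smul (of_nat (2 * p)) 1"
    using p_ge_2 by (simp add: sum.delta)
  finally show ?thesis
    using p_ge_2 by (simp add: weight_idempotent_def flip: scale_sum_right)
qed

lemma K_power_expansion: "K ^ n = (\<Sum>a\<in>roots. smul (a ^ n) (weight_idempotent a))"
proof (induction n)
  case (Suc n)
  then show ?case
    by (auto simp: sum_distrib_left smul_mult_right K_weight_idempotent mult.commute intro!: sum.cong)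
qed (simp add: sum_weight_idempotent)

lemma coord_weight_idempotent:
  assumes a: "a \<in> roots"
  shows "coord a (x * weight_idempotent a) i j = coord a x i j"
proof -
  have cancel: "inverse a ^ n * (a ^ n * c) = c" for n c
    using roots_nonzero[OF a] by (simp flip: mult.assoc power_mult_distrib)
  then show ?thesis
    using a p_ge_2
    by (simp add: weight_idempotent_def smul_mult_right sum_distrib_left coord_mult_K_power cancel)
qed

text \<open>The monomials span and both sides are linear, so it suffices to compare them on a monomial, whose
  coordinates are known.\<close>

lemma PBW_expansion:
  "x = (\<Sum>(a, i, j)\<in>roots \<times> {..<p} \<times> {..<p}. smul (coord a x i j) (F ^ i * E ^ j * weight_idempotent a))"
proof (induction x rule: monomial_induct)
  case (monomial i j n)
  have "(\<Sum>(a, i', j')\<in>roots \<times> {..<p} \<times> {..<p}.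
        smul (coord a (F ^ i * E ^ j * K ^ n) i' j') (F ^ i' * E ^ j' * weight_idempotent a))
      = (\<Sum>a\<in>roots. \<Sum>i'<p. \<Sum>j'<p. if j' = j then if i' = i then smul (a ^ n) (F ^ i' * E ^ j' * weight_idempotent a) else 0 else 0)"
    unfolding sum.cartesian_product[symmetric]
    using monomial by (intro sum.cong refl) (auto simp: coord_monomial)
  also have "\<dots> = (\<Sum>a\<in>roots. smul (a ^ n) (F ^ i * E ^ j * weight_idempotent a))"
    using monomial by (simp add: sum.delta)
  also have "\<dots> = F ^ i * E ^ j * K ^ n"
    by (simp add: K_power_expansion sum_distrib_left smul_mult_right)
  finally show ?case by simp
next
  case (add x y)
  have "(\<Sum>(a, i, j)\<in>roots \<times> {..<p} \<times> {..<p}. smul (coord a (x + y) i j) (F ^ i * E ^ j * weight_idempotent a))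
      = (\<Sum>(a, i, j)\<in>roots \<times> {..<p} \<times> {..<p}. smul (coord a x i j) (F ^ i * E ^ j * weight_idempotent a))
      + (\<Sum>(a, i, j)\<in>roots \<times> {..<p} \<times> {..<p}. smul (coord a y i j) (F ^ i * E ^ j * weight_idempotent a))"
    by (simp only: sum.distrib[symmetric] split_def)
       (intro sum.cong refl, auto simp: scale_left_distrib)
  with add show ?case by simp
next
  case (smul c x)
  have "(\<Sum>(a, i, j)\<in>roots \<times> {..<p} \<times> {..<p}. smul (coord a (smul c x) i j) (F ^ i * E ^ j * weight_idempotent a))
      = smul c (\<Sum>(a, i, j)\<in>roots \<times> {..<p} \<times> {..<p}. smul (coord a x i j) (F ^ i * E ^ j * weight_idempotent a))"
    by (simp only: scale_sum_right split_def) (intro sum.cong refl, auto)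
  with smul show ?case by simp
qed

lemma coord_eqI:
  assumes "\<And>a i j. a \<in> roots \<Longrightarrow> i < p \<Longrightarrow> j < p \<Longrightarrow> coord a x i j = coord a y i j"
  shows "x = y"
  by (subst PBW_expansion[of x], subst PBW_expansion[of y]) (intro sum.cong refl, auto simp: assms)

end

context restricted_sl2
begin

section \<open>The distinguished group-like element\<close>

abbreviation linear_functional :: "('u \<Rightarrow> 'k) \<Rightarrow> bool" where
  "linear_functional \<equiv> Vector_Spaces.linear smul (*)"

lemma bilinear_map_sweedler:
  assumes s: "vector_space s" and B: "bilinear_map smul s B"
  shows "bilinear_map smul s (\<lambda>a b. sweedler x (\<lambda>c d. B (a * c) (b * d)))"
proof -
  interpret s: vector_space s by fact
  have scale: "s k (sweedler x C) = sweedler x (\<lambda>c d. s k (C c d))" for k C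
    by (rule sweedler_additive) (simp add: s.scale_right_distrib)
  show ?thesis
    using B unfolding bilinear_map_def
    by (simp add: distrib_right smul_mult_left sweedler_distrib scale)
qed

context
  fixes s :: "'k \<Rightarrow> 'w::ab_group_add \<Rightarrow> 'w" and B :: "'u \<Rightarrow> 'u \<Rightarrow> 'w"
  assumes s: "vector_space s" and B: "bilinear_map smul s B"
begin

lemma sweedler_E: "sweedler E B = B 1 E + B E K"
  and sweedler_F: "sweedler F B = B Kinv F + B F 1"
  and sweedler_K: "sweedler K B = B K K"
  using sweedler_tensor_eq[OF s B comul_E] sweedler_tensor_eq[OF s B comul_F]
    sweedler_tensor_eq[OF s B comul_K]
  by (simp_all add: Kinv_def)

end

context
  fixes s :: "'k \<Rightarrow> 'w::ab_group_add \<Rightarrow> 'w" and B :: "'u \<Rightarrow> 'u \<Rightarrow> 'w"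
  assumes s: "vector_space s" and B: "bilinear_map smul s B"
begin

lemma sweedler_F_mult:
  "sweedler (F * x) B = sweedler x (\<lambda>c d. B (Kinv * c) (F * d)) + sweedler x (\<lambda>c d. B (F * c) d)"
  by (simp add: sweedler_mult[OF s B] sweedler_F[OF s bilinear_map_sweedler[OF s B]])

lemma bilinear_map_mult_left: "bilinear_map smul s (\<lambda>c d. B (a * c) (b * d))"
  using B by (simp add: bilinear_map_def distrib_left smul_mult_right)

lemma sweedler_mult_E:
  "sweedler (x * E) B = sweedler x (\<lambda>c d. B c (d * E)) + sweedler x (\<lambda>c d. B (c * E) (d * K))"
  by (simp add: sweedler_mult[OF s B] sweedler_E[OF s bilinear_map_mult_left] sweedler_distrib)

lemma sweedler_mult_K: "sweedler (x * K) B = sweedler x (\<lambda>c d. B (c * K) (d * K))"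
  by (simp add: sweedler_mult[OF s B] sweedler_K[OF s bilinear_map_mult_left])

end

text \<open>The convolution actions \<open>x \<mapsto> x\<^sub>1 f(x\<^sub>2)\<close> and \<open>x \<mapsto> f(x\<^sub>1) x\<^sub>2\<close> of functionals. A right integral \<open>\<lambda>\<close> and its
  distinguished group-like \<open>g\<close> satisfy \<open>\<lambda>(x\<^sub>1 f(x\<^sub>2)) = f(1) \<lambda>(x)\<close> and \<open>\<lambda>(f(x\<^sub>1) x\<^sub>2) = f(g) \<lambda>(x)\<close>. For
  coordinate functionals \<open>f\<close> the actions are explicit on monomials, which determines where \<open>\<lambda>\<close> vanishes
  and then \<open>g\<close>.\<close>

definition right_conv :: "('u \<Rightarrow> 'k) \<Rightarrow> 'u \<Rightarrow> 'u" where
  "right_conv f x = sweedler x (\<lambda>a b. smul (f b) a)"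

definition left_conv :: "('u \<Rightarrow> 'k) \<Rightarrow> 'u \<Rightarrow> 'u" where
  "left_conv f x = sweedler x (\<lambda>a b. smul (f a) b)"

lemma linear_functionalD:
  assumes "linear_functional f"
  shows "f (x + y) = f x + f y" "f (smul c x) = c * f x"
  using assms by (simp_all add: Vector_Spaces.linear_iff)

lemma linear_functional_coord: "a \<in> roots \<Longrightarrow> linear_functional (\<lambda>x. coord a x i j)"
  by (simp add: Vector_Spaces.linear_iff vector_space_axioms vector_space_field)

context
  fixes f :: "'u \<Rightarrow> 'k"
  assumes f: "linear_functional f"
begin

lemma bilinear_right_conv: "bilinear_map smul smul (\<lambda>a b. smul (f b) a)"
  and bilinear_left_conv: "bilinear_map smul smul (\<lambda>a b. smul (f a) b)"
  by (auto intro!: bilinear_mapI simp: linear_functionalD[OF f] scale_right_distrib scale_left_distrib mult.commute)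

lemma right_conv_add: "right_conv f (x + y) = right_conv f x + right_conv f y"
  and right_conv_smul: "right_conv f (smul c x) = smul c (right_conv f x)"
  and left_conv_add: "left_conv f (x + y) = left_conv f x + left_conv f y"
  and left_conv_smul: "left_conv f (smul c x) = smul c (left_conv f x)"
  and right_conv_one: "right_conv f 1 = smul (f 1) 1"
  and left_conv_one: "left_conv f 1 = smul (f 1) 1"
  by (simp_all add: right_conv_def left_conv_def sweedler_add[OF smul_vs bilinear_right_conv]
      sweedler_add[OF smul_vs bilinear_left_conv] sweedler_scale[OF smul_vs bilinear_right_conv]
      sweedler_scale[OF smul_vs bilinear_left_conv] sweedler_one[OF smul_vs bilinear_right_conv]
      sweedler_one[OF smul_vs bilinear_left_conv])

lemmas right_conv_generators =
  sweedler_F_mult[OF smul_vs bilinear_right_conv, folded right_conv_def]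
  sweedler_mult_E[OF smul_vs bilinear_right_conv, folded right_conv_def]
  sweedler_mult_K[OF smul_vs bilinear_right_conv, folded right_conv_def]

lemmas left_conv_generators =
  sweedler_F_mult[OF smul_vs bilinear_left_conv, folded left_conv_def]
  sweedler_mult_E[OF smul_vs bilinear_left_conv, folded left_conv_def]
  sweedler_mult_K[OF smul_vs bilinear_left_conv, folded left_conv_def]

lemma right_integral_right_conv:
  assumes "right_integral smul comul lam"
  shows "lam (right_conv f x) = f 1 * lam x"
proof -
  have lam: "linear_functional lam" and int: "sweedler x (\<lambda>a b. smul (lam a) b) = smul (lam x) 1"
    using assms by (simp_all add: right_integral_def sweedler_def)
  have "lam (right_conv f x) = sweedler x (\<lambda>a b. f b * lam a)"
    unfolding right_conv_def
    by (subst sweedler_additive[of lam]) (simp_all add: linear_functionalD[OF lam])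
  also have "\<dots> = f (sweedler x (\<lambda>a b. smul (lam a) b))"
    by (subst sweedler_additive[of f]) (simp_all add: linear_functionalD[OF f] mult.commute)
  finally show ?thesis
    by (simp add: int linear_functionalD[OF f])
qed

lemma distinguished_left_conv:
  assumes lam: "linear_functional lam" and g: "distinguished_group_like smul comul lam g"
  shows "lam (left_conv f x) = f g * lam x"
proof -
  have int: "sweedler x (\<lambda>a b. smul (lam b) a) = smul (lam x) g"
    using g by (simp add: distinguished_group_like_def sweedler_def)
  have "lam (left_conv f x) = sweedler x (\<lambda>a b. f a * lam b)"
    unfolding left_conv_def
    by (subst sweedler_additive[of lam]) (simp_all add: linear_functionalD[OF lam])
  also have "\<dots> = f (sweedler x (\<lambda>a b. smul (lam b) a))"
    by (subst sweedler_additive[of f]) (simp_all add: linear_functionalD[OF f] mult.commute)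
  finally show ?thesis
    by (simp add: int linear_functionalD[OF f])
qed

lemma group_like_conv:
  assumes "group_like smul comul g"
  shows "right_conv f g = smul (f g) g" "left_conv f g = smul (f g) g"
  using assms sweedler_tensor_eq[OF smul_vs bilinear_right_conv, of g "[(g, g)]"]
    sweedler_tensor_eq[OF smul_vs bilinear_left_conv, of g "[(g, g)]"]
  by (simp_all add: right_conv_def left_conv_def group_like_def)

end

lemma coord_top_Kinv:
  assumes a: "a \<in> roots"
  shows "coord a (Kinv * x) 0 0 = inverse a * coord a x 0 0"
proof -
  have "coord a (K * (Kinv * x)) 0 0 = a * coord a (Kinv * x) 0 0"
    by (simp add: coord_K[OF a] weight_def)
  then show ?thesis
    using roots_nonzero[OF a] by (simp add: K_Kinv_assoc field_simps)
qed

text \<open>The coefficient of the generating vector. It vanishes at \<open>F x\<close> and \<open>x E\<close> and turns a factor \<open>K\<close> into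
  \<open>a\<close>, so monomials are eigenvectors of its two convolution actions.\<close>

abbreviation top_coord :: "'k \<Rightarrow> 'u \<Rightarrow> 'k" where
  "top_coord a \<equiv> \<lambda>x. coord a x 0 0"

context
  fixes a :: 'k
  assumes a: "a \<in> roots"
begin

lemma right_conv_top:
  "right_conv (top_coord a) (F * x) = F * right_conv (top_coord a) x"
  "right_conv (top_coord a) (x * E) = smul a (right_conv (top_coord a) x * E)"
  "right_conv (top_coord a) (x * K) = smul a (right_conv (top_coord a) x * K)"
  "right_conv (top_coord a) 1 = 1"
  using right_conv_generators[OF linear_functional_coord[OF a]] right_conv_one[OF linear_functional_coord[OF a]]
  by (simp_all add: coord_F[OF a] coord_mult_E[OF a] coord_mult_K[OF a] coord_one[OF a] right_conv_def
      sweedler_mult_left sweedler_mult_right sweedler_smul smul_mult_left smul_mult_right)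

lemma left_conv_top:
  "left_conv (top_coord a) (F * x) = smul (inverse a) (F * left_conv (top_coord a) x)"
  "left_conv (top_coord a) (x * E) = left_conv (top_coord a) x * E"
  "left_conv (top_coord a) (x * K) = smul a (left_conv (top_coord a) x * K)"
  "left_conv (top_coord a) 1 = 1"
  using left_conv_generators[OF linear_functional_coord[OF a]] left_conv_one[OF linear_functional_coord[OF a]]
  by (simp_all add: coord_F[OF a] coord_mult_E[OF a] coord_mult_K[OF a] coord_one[OF a] left_conv_def
      coord_top_Kinv[OF a] sweedler_mult_left sweedler_mult_right sweedler_smul smul_mult_left smul_mult_right)

lemma right_conv_top_monomial:
  "right_conv (top_coord a) (F ^ i * E ^ j * K ^ n) = smul (a ^ (j + n)) (F ^ i * E ^ j * K ^ n)"
proof -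
  have "right_conv (top_coord a) (F ^ i) = F ^ i"
    by (induction i) (simp_all add: right_conv_top)
  then have "right_conv (top_coord a) (F ^ i * E ^ j) = smul (a ^ j) (F ^ i * E ^ j)"
    by (induction j) (simp_all only: power_Suc2 mult.assoc[symmetric] right_conv_top smul_mult_left, simp_all add: mult.commute)
  then show ?thesis
    by (induction n) (simp_all only: power_Suc2 mult.assoc[symmetric] right_conv_top smul_mult_left add_Suc_right, simp_all add: mult.commute)
qed

lemma left_conv_top_monomial:
  "left_conv (top_coord a) (F ^ i * E ^ j * K ^ n) = smul (inverse a ^ i * a ^ n) (F ^ i * E ^ j * K ^ n)"
proof -
  have "left_conv (top_coord a) (F ^ i) = smul (inverse a ^ i) (F ^ i)"
    by (induction i) (simp_all add: left_conv_top smul_mult_right mult.commute)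
  then have "left_conv (top_coord a) (F ^ i * E ^ j) = smul (inverse a ^ i) (F ^ i * E ^ j)"
    by (induction j) (simp_all only: power_Suc2 mult.assoc[symmetric] left_conv_top smul_mult_left, simp_all)
  then show ?thesis
    by (induction n) (simp_all only: power_Suc2 mult.assoc[symmetric] left_conv_top smul_mult_left, simp_all add: mult_ac)
qed

lemma coord_conv:
  assumes b: "b \<in> roots"
  shows "coord b (right_conv (top_coord a) x) i j = a ^ j * coord (a * b) x i j"
    and "coord b (left_conv (top_coord a) x) i j = inverse a ^ i * coord (a * b) x i j"
proof (induction x rule: monomial_induct)
  have ab: "a * b \<in> roots" by (intro roots_mult a b)
  {
    case (monomial i' j' n)
    {
      case 1
      show ?case
        unfolding right_conv_top_monomial coord_smul[OF b] coord_monomial[OF b monomial] coord_monomial[OF ab monomial]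
        by (simp add: power_add power_mult_distrib mult_ac)
    next
      case 2
      show ?case
        unfolding left_conv_top_monomial coord_smul[OF b] coord_monomial[OF b monomial] coord_monomial[OF ab monomial]
        by (simp add: power_mult_distrib mult_ac)
    }
  next
    case (add x y)
    {
      case 1
      show ?case using add
        by (simp add: b ab right_conv_add[OF linear_functional_coord[OF a]] distrib_left)
    next
      case 2
      show ?case using add
        by (simp add: b ab left_conv_add[OF linear_functional_coord[OF a]] distrib_left)
    }
  next
    case (smul c x)
    {
      case 1
      show ?case using smul
        by (simp add: b ab right_conv_smul[OF linear_functional_coord[OF a]])
    next
      case 2
      show ?case using smul
        by (simp add: b ab left_conv_smul[OF linear_functional_coord[OF a]])
    }
  }
qed

end

text \<open>The coefficient of \<open>E\<close> at weight \<open>1\<close> is a skew derivation: its convolution action deletes one factor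
  \<open>E\<close> from a monomial, with a nonzero scalar as long as fewer than \<open>p\<close> factors are present.\<close>

lemma right_conv_E_coord:
  "right_conv (\<lambda>x. coord 1 x 0 1) (F ^ i * E ^ Suc j * K ^ n)
     = smul (\<Sum>s<Suc j. (q ^ 2) ^ s) (F ^ i * E ^ j * K ^ n)"
proof -
  let ?X = "right_conv (\<lambda>x. coord 1 x 0 1)"
  have gens: "?X (F * x) = F * ?X x" "?X (x * E) = right_conv (top_coord (q ^ 2)) x + ?X x * E"
    "?X (x * K) = ?X x * K" "?X 1 = 0" for x
    using right_conv_generators[OF linear_functional_coord[OF one_in_roots], of 0 1]
      right_conv_one[OF linear_functional_coord[OF one_in_roots], of 0 1] p_ge_2
    by (simp_all add: coord_F coord_mult_E coord_mult_K coord_one right_conv_def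
        sweedler_mult_left sweedler_mult_right sweedler_smul smul_mult_left smul_mult_right)
  have "?X (F ^ i) = 0"
    by (induction i) (simp_all only: power_Suc power_0 gens mult_zero_right)
  moreover have "right_conv (top_coord (q ^ 2)) (F ^ i * E ^ j) = smul ((q ^ 2) ^ j) (F ^ i * E ^ j)" for j
    using right_conv_top_monomial[of "q ^ 2" i j 0] by simp
  ultimately have "?X (F ^ i * E ^ Suc j) = smul (\<Sum>s<Suc j. (q ^ 2) ^ s) (F ^ i * E ^ j)"
  proof (induction j)
    case 0
    then show ?case using gens(2)[of "F ^ i"] 0(2)[of 0] by simp
  next
    case (Suc j)
    have "?X (F ^ i * E ^ Suc (Suc j)) = ?X ((F ^ i * E ^ Suc j) * E)"
      by (simp only: power_Suc2 mult.assoc)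
    also have "\<dots> = smul ((q ^ 2) ^ Suc j) (F ^ i * E ^ Suc j) + ?X (F ^ i * E ^ Suc j) * E"
      by (simp only: gens Suc.prems)
    also have "?X (F ^ i * E ^ Suc j) * E = smul (\<Sum>s<Suc j. (q ^ 2) ^ s) (F ^ i * E ^ Suc j)"
      unfolding Suc.IH[OF Suc.prems] by (simp add: smul_mult_left mult.assoc power_commutes)
    finally show ?case
      unfolding sum.lessThan_Suc[of _ "Suc j"] scale_left_distrib by (simp only: add.commute)
  qed
  then show ?thesis
    by (induction n) (simp_all only: power_Suc2[of K] mult.assoc[symmetric] gens smul_mult_left, simp_all)
qed

lemma F_Kinv: "F * Kinv = smul (inverse q ^ 2) (Kinv * F)"
proof -
  have "F * Kinv = Kinv * (K * F) * Kinv"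
    by (simp add: Kinv_K flip: mult.assoc)
  also have "\<dots> = smul (inverse q ^ 2) (Kinv * F)"
    unfolding K_F by (simp add: smul_mult_left smul_mult_right mult.assoc K_Kinv)
  finally show ?thesis .
qed

text \<open>The same for the coefficient of \<open>F\<close>.\<close>

lemma right_conv_F_coord:
  "right_conv (\<lambda>x. coord 1 x 1 0) (F ^ Suc i * E ^ j * K ^ n)
     = smul (\<Sum>s<Suc i. (inverse q ^ 2) ^ s) (Kinv * (F ^ i * E ^ j * K ^ n))"
proof -
  let ?Y = "right_conv (\<lambda>x. coord 1 x 1 0)"
  have gens: "?Y (F * x) = Kinv * right_conv (top_coord 1) x + F * ?Y x" "?Y (x * E) = ?Y x * E"
    "?Y (x * K) = ?Y x * K" "?Y 1 = 0" for x
    using right_conv_generators[OF linear_functional_coord[OF one_in_roots], of 1 0]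
      right_conv_one[OF linear_functional_coord[OF one_in_roots], of 1 0] p_ge_2
    by (simp_all add: coord_F coord_mult_E coord_mult_K coord_one right_conv_def
        sweedler_mult_left sweedler_mult_right sweedler_smul smul_mult_left smul_mult_right)
  have "?Y (E ^ j) = 0"
    by (induction j) (simp_all only: power_Suc2 power_0 gens mult_zero_left)
  then have base: "?Y (E ^ j * K ^ n) = 0"
    by (induction n) (simp_all only: power_Suc2 power_0 mult.assoc[symmetric] gens mult_zero_left mult_1_right)
  have fixed: "right_conv (top_coord 1) (F ^ i * (E ^ j * K ^ n)) = F ^ i * (E ^ j * K ^ n)" for i
    using right_conv_top_monomial[of 1 i j n] by (simp add: mult.assoc)
  have step: "?Y (F ^ Suc m * (E ^ j * K ^ n)) = Kinv * (F ^ m * (E ^ j * K ^ n)) + F * ?Y (F ^ m * (E ^ j * K ^ n))" for m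
    using gens(1)[of "F ^ m * (E ^ j * K ^ n)"] by (simp add: fixed mult.assoc)
  have "?Y (F ^ Suc i * (E ^ j * K ^ n))
      = smul (\<Sum>s<Suc i. (inverse q ^ 2) ^ s) (Kinv * (F ^ i * (E ^ j * K ^ n)))"
  proof (induction i)
    case 0
    show ?case using step[of 0] base by simp
  next
    case (Suc i)
    let ?t = "Kinv * (F ^ Suc i * (E ^ j * K ^ n))" and ?c = "\<Sum>s<Suc i. (inverse q ^ 2) ^ s"
    have "?Y (F ^ Suc (Suc i) * (E ^ j * K ^ n)) = ?t + smul ?c ((F * Kinv) * (F ^ i * (E ^ j * K ^ n)))"
      unfolding step[of "Suc i"] Suc by (simp only: smul_mult_right mult.assoc)
    also have "\<dots> = smul (1 + inverse q ^ 2 * ?c) ?t"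
      by (simp add: F_Kinv smul_mult_left scale_left_distrib mult.assoc mult.commute)
    also have "1 + inverse q ^ 2 * ?c = (\<Sum>s<Suc (Suc i). (inverse q ^ 2) ^ s)"
      unfolding sum.lessThan_Suc_shift[of _ "Suc i"] by (simp only: sum_distrib_left power_Suc power_0)
    finally show ?case .
  qed
  then show ?thesis by (simp only: mult.assoc)
qed

lemma geometric_sum_q_nonzero:
  assumes "0 < n" "n < p"
  shows "(\<Sum>s<n. (q ^ 2) ^ s) \<noteq> 0" "(\<Sum>s<n. (inverse q ^ 2) ^ s) \<noteq> 0"
proof -
  have "(q ^ 2) ^ n \<noteq> 1"
    using assms q_power_neq_1[of "2 * n"] by (simp add: power_mult)
  moreover have "(inverse q ^ 2) ^ n \<noteq> 1" "inverse q ^ 2 \<noteq> 1"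
    using calculation q2_neq_1 by (simp_all add: power_inverse)
  ultimately show "(\<Sum>s<n. (q ^ 2) ^ s) \<noteq> 0" "(\<Sum>s<n. (inverse q ^ 2) ^ s) \<noteq> 0"
    using q2_neq_1 by (simp_all add: geometric_sum del: power_inverse)
qed

text \<open>The two skew derivations vanish at \<open>1\<close>, so \<open>\<lambda>\<close> vanishes on their convolution images. Up to
  nonzero scalars and powers of \<open>K\<close>, these contain every monomial to which another \<open>E\<close> or another
  \<open>F\<close> can be added.\<close>

lemma right_integral_support:
  assumes lam: "right_integral smul comul lam" and ij: "i < p" "j < p"
    and nonzero: "lam (F ^ i * E ^ j * K ^ n) \<noteq> 0"
  shows "i = p - 1 \<and> j = p - 1"
proof -
  have lin: "linear_functional lam" using lam by (simp add: right_integral_def)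
  have "\<not> Suc j < p"
  proof
    assume j: "Suc j < p"
    have "lam (right_conv (\<lambda>x. coord 1 x 0 1) (F ^ i * E ^ Suc j * K ^ n)) = 0"
      using right_integral_right_conv[OF linear_functional_coord lam, of 1 0 1] by (simp add: coord_one)
    then show False
      using nonzero geometric_sum_q_nonzero[OF _ j]
      by (simp only: right_conv_E_coord linear_functionalD[OF lin]) auto
  qed
  moreover have "\<not> Suc i < p"
  proof
    assume i: "Suc i < p"
    have "lam (right_conv (\<lambda>x. coord 1 x 1 0) (F ^ Suc i * E ^ j * K ^ Suc n)) = 0"
      using right_integral_right_conv[OF linear_functional_coord lam, of 1 1 0] by (simp add: coord_one)
    then have "lam (Kinv * (F ^ i * E ^ j * K ^ Suc n)) = 0"
      using geometric_sum_q_nonzero[OF _ i]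
      by (simp only: right_conv_F_coord linear_functionalD[OF lin]) auto
    moreover have "Kinv * (F ^ i * E ^ j * K ^ Suc n)
      = smul (inverse q ^ (2 * (2 * p - 1) * i) * q ^ (2 * (2 * p - 1) * j)) (F ^ i * E ^ j * K ^ n)"
    proof -
      have "Kinv * (F ^ i * E ^ j * K ^ Suc n) = (Kinv * F ^ i) * (E ^ j * (K * K ^ n))"
        by (simp add: mult.assoc)
      also have "\<dots> = smul (inverse q ^ (2 * (2 * p - 1) * i)) (F ^ i * ((Kinv * E ^ j) * (K * K ^ n)))"
        using K_F_power[of "2 * p - 1" i] by (simp add: Kinv_def smul_mult_left mult.assoc)
      also have "(Kinv * E ^ j) * (K * K ^ n) = smul (q ^ (2 * (2 * p - 1) * j)) (E ^ j * (Kinv * (K * K ^ n)))"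
        using K_E_power[of "2 * p - 1" j] by (simp add: Kinv_def smul_mult_left mult.assoc)
      finally show ?thesis
        by (simp add: Kinv_K_assoc smul_mult_right mult.assoc)
    qed
    ultimately show False
      using nonzero by (simp add: linear_functionalD[OF lin])
  qed
  ultimately show ?thesis using ij by auto
qed

text \<open>On a monomial \<open>F\<^sup>p\<^sup>-\<^sup>1 E\<^sup>p\<^sup>-\<^sup>1 K\<^sup>n\<close> with nonzero integral, the right action gives
  \<open>q\<^sup>p\<^sup>-\<^sup>1\<^sup>+\<^sup>n = 1\<close>, and the left action gives the value \<open>q\<^sup>n\<^sup>-\<^sup>(\<^sup>p\<^sup>-\<^sup>1\<^sup>)\<close> at \<open>g\<close>.\<close>

lemma distinguished_group_like_top_coord:
  assumes lam: "right_integral smul comul lam" and nonzero: "lam \<noteq> (\<lambda>_. 0)"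
    and g: "distinguished_group_like smul comul lam g"
  shows "coord q g 0 0 = q ^ 2"
proof -
  have lin: "linear_functional lam" using lam by (simp add: right_integral_def)
  have "\<exists>i j n. i < p \<and> j < p \<and> lam (F ^ i * E ^ j * K ^ n) \<noteq> 0"
  proof (rule ccontr)
    assume none: "\<not> ?thesis"
    have "lam x = 0" for x
      by (induction x rule: monomial_induct) (use none in \<open>auto simp: linear_functionalD[OF lin]\<close>)
    then show False using nonzero by auto
  qed
  then obtain i j n where ij: "i < p" "j < p" and ne: "lam (F ^ i * E ^ j * K ^ n) \<noteq> 0"
    by blast
  have top: "i = p - 1" "j = p - 1"
    using right_integral_support[OF lam ij ne] by auto
  have "q ^ (j + n) = 1"
    using right_integral_right_conv[OF linear_functional_coord[OF q_in_roots] lam, of 0 0 "F ^ i * E ^ j * K ^ n"] ne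
    by (simp add: right_conv_top_monomial linear_functionalD[OF lin] coord_one)
  moreover have "coord q g 0 0 = inverse q ^ i * q ^ n"
    using distinguished_left_conv[OF linear_functional_coord[OF q_in_roots] lin g, of 0 0 "F ^ i * E ^ j * K ^ n"] ne
    by (simp add: left_conv_top_monomial linear_functionalD[OF lin])
  moreover have "i + j + 2 = 2 * p"
    using top p_ge_2 by simp
  then have "q ^ i * q ^ j * q ^ 2 = 1"
    by (simp only: q_2p flip: power_add)
  moreover have "inverse q ^ i * q ^ i = 1"
    by (simp flip: power_mult_distrib)
  moreover have "inverse q ^ i * q ^ n * (q ^ i * q ^ j * q ^ 2) = (inverse q ^ i * q ^ i) * (q ^ j * q ^ n) * q ^ 2"
    by (simp only: mult_ac)
  ultimately show ?thesis
    unfolding power_add by simp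
qed

text \<open>A group-like element is an eigenvector of both convolution actions. Comparing the two kills all
  coordinates with \<open>(i, j) \<noteq> (0, 0)\<close>, and the recursion along the weights \<open>q\<^sup>m\<close> identifies the
  remaining ones with those of \<open>K\<^sup>2\<close>.\<close>

lemma distinguished_group_like_eq:
  assumes lam: "right_integral smul comul lam" "lam \<noteq> (\<lambda>_. 0)"
    and g: "distinguished_group_like smul comul lam g"
  shows "g = K ^ 2"
proof -
  have gl: "group_like smul comul g" using g by (simp add: distinguished_group_like_def)
  have top: "coord q g 0 0 = q ^ 2"
    by (rule distinguished_group_like_top_coord[OF lam g])
  note conv = group_like_conv[OF linear_functional_coord[OF q_in_roots] gl, of 0 0]
  have R: "q ^ 2 * coord b g i j = q ^ j * coord (q * b) g i j"
    and L: "q ^ 2 * coord b g i j = inverse q ^ i * coord (q * b) g i j" if "b \<in> roots" for b i j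
    using coord_conv[OF q_in_roots that, of g i j] that by (simp_all add: conv top)
  have off: "coord c g i j = 0" if c: "c \<in> roots" and "i < p" "j < p" "i \<noteq> 0 \<or> j \<noteq> 0" for c i j
  proof -
    have "inverse q * c \<in> roots" using c by (intro roots_mult roots_inverse) simp_all
    from R[OF this, of i j] L[OF this, of i j]
    have "q ^ (i + j) * coord c g i j = coord c g i j"
      by (simp add: power_add power_inverse field_simps)
    moreover have "q ^ (i + j) \<noteq> 1"
      using that by (intro q_power_neq_1) auto
    ultimately show ?thesis by simp
  qed
  have power: "coord (q ^ m) g 0 0 = q ^ (2 * m) * coord 1 g 0 0" for m
  proof (induction m)
    case (Suc m)
    then show ?case
      using R[of "q ^ m" 0 0] by (simp add: power2_eq_square mult_ac)
  qed simp
  from power[of 1] have "coord 1 g 0 0 = 1"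
    by (simp add: top)
  with power have "coord (q ^ m) g 0 0 = (q ^ m) ^ 2" for m
    by (simp add: mult.commute flip: power_mult)
  then have on: "coord c g 0 0 = c ^ 2" if "c \<in> roots" for c
    using that by (auto simp: roots_eq)
  show ?thesis
  proof (rule coord_eqI)
    fix c i j assume c: "c \<in> roots" "i < p" "j < p"
    show "coord c g i j = coord c (K ^ 2) i j"
      using coord_monomial[OF c(1), where i = 0 and j = 0 and n = 2] c off[of c i j] on[of c] p_ge_2
      by auto
  qed
qed

end

section \<open>The regular character through Verma modules\<close>

context restricted_sl2
begin

text \<open>The matrix of \<open>x\<close> on the Verma module of highest weight \<open>a\<close> in the basis \<open>F\<^sup>k v\<close>: keeping only the
  coordinates with \<open>j = 0\<close> amounts to imposing \<open>E v = 0\<close>.\<close>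

definition verma :: "'k \<Rightarrow> 'u \<Rightarrow> nat \<Rightarrow> nat \<Rightarrow> 'k" where
  "verma a x i k = coord a (x * F ^ k) i 0"

context
  fixes a :: 'k
  assumes a: "a \<in> roots"
begin

lemma verma_add [simp]: "verma a (x + y) i k = verma a x i k + verma a y i k"
  and verma_smul [simp]: "verma a (smul c x) i k = c * verma a x i k"
  and verma_diff [simp]: "verma a (x - y) i k = verma a x i k - verma a y i k"
  and verma_zero [simp]: "verma a 0 i k = 0"
  by (simp_all add: verma_def distrib_right smul_mult_left left_diff_distrib a)

lemma verma_sum [simp]: "verma a (\<Sum>x\<in>A. f x) i k = (\<Sum>x\<in>A. verma a (f x) i k)"
  by (induction A rule: infinite_finite_induct) simp_all

lemma verma_one: "k < p \<Longrightarrow> verma a 1 i k = (if i = k then 1 else 0)"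
  using coord_F_power[OF a, of k 1 i 0] by (auto simp: verma_def coord_one[OF a])

lemma verma_E: "verma a (E * x) i k = eps a i * verma a x (Suc i) k"
  and verma_F: "verma a (F * x) i k = (if 0 < i \<and> i < p then verma a x (i - 1) k else 0)"
  and verma_K: "verma a (K * x) i k = a * inverse q ^ (2 * i) * verma a x i k"
  by (simp_all add: verma_def mult.assoc coord_E[OF a] coord_F[OF a] coord_K[OF a] weight_def)

lemma verma_out: "p \<le> i \<or> p \<le> k \<Longrightarrow> verma a x i k = 0"
  using F_power_p power_add[of F p "k - p"] by (auto simp: verma_def coord_out[OF a] coord_zero[OF a])

lemma verma_mult: "verma a (x * y) i k = (\<Sum>l<p. verma a x i l * verma a y l k)"
proof (induction x arbitrary: i rule: algebra_induct)
  case one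
  have "(\<Sum>l<p. verma a 1 i l * verma a y l k) = (\<Sum>l<p. if l = i then verma a y l k else 0)"
    by (rule sum.cong) (auto simp: verma_one)
  then show ?case
    by (auto simp: sum.delta verma_out)
qed (simp_all add: mult.assoc verma_E verma_F verma_K distrib_right smul_mult_left sum_distrib_left sum.distrib)

lemma verma_mult_F: "verma a (x * F) i k = verma a x i (Suc k)"
  by (simp add: verma_def mult.assoc)

lemma verma_mult_K: "verma a (x * K) i k = a * inverse q ^ (2 * k) * verma a x i k"
proof -
  have "x * K * F ^ k = smul (inverse q ^ (2 * k)) (x * F ^ k * K)"
    using K_F_power[of 1 k] by (simp add: mult.assoc smul_mult_right)
  then show ?thesis
    by (simp add: verma_def coord_mult_K[OF a] a)
qed

lemma verma_mult_E: "Suc k < p \<Longrightarrow> verma a (x * E) i (Suc k) = verma a x i k * eps a k"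
proof -
  assume k: "Suc k < p"
  have "verma a E l (Suc k) = (if l = k then eps a k else 0)" for l
    using verma_E[of 1 l "Suc k"] k by (simp add: verma_one)
  then show ?thesis
    using k by (simp add: verma_mult sum.delta if_distrib[of "\<lambda>z. _ * z"] cong: if_cong)
qed

lemma verma_Kinv: "verma a (Kinv * x) i k = inverse a * q ^ (2 * i) * verma a x i k"
  and verma_mult_Kinv: "verma a (x * Kinv) i k = inverse a * q ^ (2 * k) * verma a x i k"
proof -
  have "a \<noteq> 0" using a by (rule roots_nonzero)
  then show "verma a (Kinv * x) i k = inverse a * q ^ (2 * i) * verma a x i k"
    using verma_K[of "Kinv * x" i k] by (simp add: K_Kinv_assoc power_inverse field_simps)
  show "verma a (x * Kinv) i k = inverse a * q ^ (2 * k) * verma a x i k"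
    using verma_mult_K[of "x * Kinv" i k] \<open>a \<noteq> 0\<close>
    by (simp add: mult.assoc Kinv_K power_inverse field_simps)
qed

end

lemma linear_left_mult: "Vector_Spaces.linear smul smul ((*) x)"
  by (simp add: Vector_Spaces.linear_iff vector_space_axioms distrib_left smul_mult_right)

text \<open>The diagonal coordinate of \<open>x\<close> at \<open>F\<^sup>i E\<^sup>j v\<close> is the \<open>i\<close>-th diagonal entry of \<open>x\<close> on the Verma module generated by
  \<open>E\<^sup>j v\<close>, of weight \<open>a q\<^sup>2\<^sup>j\<close>; for each of the \<open>p\<close> values of \<open>j\<close> these weights run through all roots.\<close>

lemma regular_character_verma:
  "regular_character smul x = of_nat p * (\<Sum>a\<in>roots. \<Sum>i<p. verma a x i i)"
proof -
  let ?I = "roots \<times> {..<p} \<times> {..<p}"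
  let ?phi = "\<lambda>(a, i, j) x. coord a x i j" and ?e = "\<lambda>(a, i, j). F ^ i * E ^ j * weight_idempotent a"
  have "regular_character smul x = (\<Sum>t\<in>?I. ?phi t (x * ?e t))"
    unfolding regular_character_def
  proof (rule lin_trace_coordinates[OF _ _ _ linear_left_mult])
    show "finite ?I" by simp
    show "Vector_Spaces.linear smul (*) (?phi t)" if "t \<in> ?I" for t
      using that linear_functional_coord by auto
    show "y = (\<Sum>t\<in>?I. smul (?phi t y) (?e t))" for y
      using PBW_expansion[of y] by (simp add: split_def)
  qed
  also have "\<dots> = (\<Sum>a\<in>roots. \<Sum>i<p. \<Sum>j<p. coord a (x * (F ^ i * E ^ j * weight_idempotent a)) i j)"
    by (simp add: split_def sum.cartesian_product)
  also have "\<dots> = (\<Sum>a\<in>roots. \<Sum>i<p. \<Sum>j<p. verma (a * q ^ (2 * j)) x i i)"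
  proof (intro sum.cong refl)
    fix a i j assume "a \<in> roots" "j \<in> {..<p}"
    then have "coord a (x * F ^ i * E ^ j * weight_idempotent a) i j = verma (a * q ^ (2 * j)) x i i"
      by (simp add: coord_weight_idempotent coord_mult_E_power verma_def)
    then show "coord a (x * (F ^ i * E ^ j * weight_idempotent a)) i j = verma (a * q ^ (2 * j)) x i i"
      by (simp add: mult.assoc)
  qed
  also have "\<dots> = (\<Sum>a\<in>roots. \<Sum>j<p. \<Sum>i<p. verma (a * q ^ (2 * j)) x i i)"
    by (intro sum.cong refl sum.swap)
  also have "\<dots> = (\<Sum>j<p. \<Sum>a\<in>roots. \<Sum>i<p. verma (a * q ^ (2 * j)) x i i)"
    by (rule sum.swap)
  also have "\<dots> = (\<Sum>j<p. \<Sum>a\<in>roots. \<Sum>i<p. verma a x i i)"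
    by (intro sum.cong refl sum_roots_shift[where f = "\<lambda>a. \<Sum>i<p. verma a x i i"]) simp
  finally show ?thesis by simp
qed

section \<open>The antipode\<close>

lemma antipode_minus: "antipode (- x) = - antipode x"
  using antipode_smul[of "- 1" x] by simp

lemma antipode_generators:
  "antipode E = - (E * Kinv)" "antipode F = - (K * F)" "antipode K = Kinv" "antipode Kinv = K"
proof -
  show E: "antipode E = - (E * Kinv)" "antipode F = - (K * F)" and K: "antipode K = Kinv"
    using antipode_E antipode_F antipode_K by (simp_all add: Kinv_def)
  have "antipode Kinv * Kinv = 1"
    using antipode_mult[of K Kinv] by (simp add: K_Kinv K)
  then have "antipode Kinv * Kinv * K = K" by simp
  then show "antipode Kinv = K" by (simp add: mult.assoc Kinv_K)
qed

text \<open>Both sides are algebra endomorphisms that agree on the generators.\<close>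

lemma antipode_square: "antipode (antipode x) = K * x * Kinv"
proof (induction x rule: algebra_induct)
  case one
  show ?case by (simp add: K_Kinv)
next
  case (E y)
  have "antipode (antipode (E * y)) = antipode (antipode E) * antipode (antipode y)"
    by (simp add: antipode_mult)
  then show ?case
    by (simp add: E antipode_generators antipode_mult antipode_minus mult.assoc Kinv_K_assoc)
next
  case (F y)
  have "antipode (antipode (F * y)) = antipode (antipode F) * antipode (antipode y)"
    by (simp add: antipode_mult)
  then show ?case
    by (simp add: F antipode_generators antipode_mult antipode_minus mult.assoc Kinv_K_assoc)
next
  case (K y)
  have "antipode (antipode (K * y)) = antipode (antipode K) * antipode (antipode y)"
    by (simp add: antipode_mult)
  then show ?case
    by (simp add: K antipode_generators mult.assoc)
qed (simp_all add: distrib_left distrib_right smul_mult_left smul_mult_right)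

lemma inv_antipode: "inv antipode x = Kinv * antipode x * K"
proof (rule inv_f_eq)
  show "inj antipode"
  proof (rule injI)
    fix x y assume "antipode x = antipode y"
    then have "Kinv * (K * x * Kinv) * K = Kinv * (K * y * Kinv) * K"
      by (simp flip: antipode_square)
    then show "x = y" by (simp add: mult.assoc Kinv_K Kinv_K_assoc)
  qed
  show "antipode (Kinv * antipode x * K) = x"
    by (simp add: antipode_mult antipode_generators antipode_square mult.assoc Kinv_K_assoc Kinv_K)
qed

lemma mult_inverse_K2: "mult_inverse (K ^ 2) = Kinv * Kinv"
  unfolding mult_inverse_def
proof (rule the_equality)
  show "K ^ 2 * (Kinv * Kinv) = 1 \<and> Kinv * Kinv * K ^ 2 = 1"
    by (simp add: power2_eq_square mult.assoc K_Kinv_assoc Kinv_K_assoc K_Kinv Kinv_K)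
  fix y assume "K ^ 2 * y = 1 \<and> y * K ^ 2 = 1"
  then have "Kinv * Kinv * (K ^ 2 * y) = Kinv * Kinv" by simp
  then show "y = Kinv * Kinv"
    by (simp add: power2_eq_square mult.assoc Kinv_K_assoc)
qed

lemma commutator_eq_ad:
  "commutator comul antipode (K ^ 2) x y
     = sweedler y (\<lambda>b c. ad x (K * b * Kinv) * (Kinv * antipode c * Kinv))"
proof -
  have "commutator comul antipode (K ^ 2) x y = sweedler x (\<lambda>a1 a2. sweedler y (\<lambda>b c.
      a1 * (K * b * Kinv) * antipode a2 * (Kinv * antipode c * K) * (Kinv * Kinv)))"
    by (simp add: commutator_def sweedler_def antipode_square inv_antipode mult_inverse_K2)
  also have "\<dots> = sweedler y (\<lambda>b c. sweedler x (\<lambda>a1 a2.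
      a1 * (K * b * Kinv) * antipode a2 * (Kinv * antipode c * K) * (Kinv * Kinv)))"
    by (rule sweedler_swap)
  also have "\<dots> = sweedler y (\<lambda>b c. ad x (K * b * Kinv) * (Kinv * antipode c * Kinv))"
    by (simp add: ad_def sweedler_mult_right mult.assoc K_Kinv_assoc)
  finally show ?thesis .
qed

section \<open>The adjoint action of the integral\<close>

lemma ad_generators:
  "ad E y = E * y * Kinv - y * E * Kinv" "ad F y = F * y - Kinv * y * K * F" "ad K y = K * y * Kinv"
  unfolding ad_def sweedler_E[OF smul_vs bilinear_ad] sweedler_F[OF smul_vs bilinear_ad]
    sweedler_K[OF smul_vs bilinear_ad]
  by (simp_all add: antipode_generators mult.assoc)

definition integral_element :: 'u where
  "integral_element = F ^ (p - 1) * E ^ (p - 1) * (\<Sum>j=0..2 * p - 1. K ^ j)"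

lemma K_integral: "K * integral_element = integral_element"
proof -
  have range: "{0..2 * p - 1} = {..<2 * p}" using p_ge_2 by auto
  have "(\<Sum>j<2 * p. K ^ Suc j) = (\<Sum>j<2 * p. K ^ j)"
    using sum.lessThan_Suc_shift[of "\<lambda>j. K ^ j" "2 * p"] sum.lessThan_Suc[of "\<lambda>j. K ^ j" "2 * p"]
    by (simp add: K_power_2p)
  then have sum: "K * (\<Sum>j<2 * p. K ^ j) = (\<Sum>j<2 * p. K ^ j)"
    by (simp add: sum_distrib_left)
  have "K * (F ^ (p - 1) * E ^ (p - 1)) = smul (inverse q ^ (2 * (p - 1)) * q ^ (2 * (p - 1))) (F ^ (p - 1) * E ^ (p - 1) * K)"
    using K_F_power[of 1 "p - 1"] K_E_power[of 1 "p - 1"]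
    by (simp add: smul_mult_left smul_mult_right mult.assoc flip: mult.assoc[of K])
  also have "inverse q ^ (2 * (p - 1)) * q ^ (2 * (p - 1)) = 1"
    by (simp flip: power_mult_distrib)
  finally have "K * (F ^ (p - 1) * E ^ (p - 1)) = F ^ (p - 1) * E ^ (p - 1) * K" by simp
  then have "K * integral_element = F ^ (p - 1) * E ^ (p - 1) * (K * (\<Sum>j<2 * p. K ^ j))"
    unfolding integral_element_def range by (simp flip: mult.assoc)
  then show ?thesis by (simp only: sum integral_element_def range)
qed

lemma F_integral: "F * integral_element = 0"
proof -
  have "F * F ^ (p - 1) = 0"
    using F_power_p p_ge_2 by (simp flip: power_Suc)
  then show ?thesis by (simp add: integral_element_def flip: mult.assoc)
qed

text \<open>\<open>K \<Lambda> = \<Lambda>\<close> and \<open>F \<Lambda> = 0\<close> say that \<open>ad K\<close> fixes \<open>ad \<Lambda> y\<close> and \<open>ad F\<close> kills it, which by the formulas for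
  \<open>ad K\<close> and \<open>ad F\<close> are commutation relations.\<close>

lemma ad_integral_commutes:
  defines "N \<equiv> \<lambda>y. ad integral_element y"
  shows "K * N y = N y * K" and "F * N y = N y * F"
proof -
  have "ad K (N y) = N y"
    using ad_mult[of K integral_element y] by (simp add: N_def K_integral)
  then have "K * N y * Kinv * K = N y * K" by (simp add: ad_generators)
  then show K: "K * N y = N y * K" by (simp add: mult.assoc Kinv_K)
  have "ad F (N y) = 0"
    using ad_mult[of F integral_element y] by (simp add: N_def F_integral)
  then have "F * N y = Kinv * (N y * K) * F" by (simp add: ad_generators mult.assoc)
  then show "F * N y = N y * F" unfolding K[symmetric] by (simp add: mult.assoc Kinv_K_assoc)
qed

end

section \<open>A Gauss product at a root of unity\<close>

context even_root_of_unity
begin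

text \<open>The coefficient of \<open>T\<^sup>s\<close> in \<open>\<Prod>\<^sub>l\<^sub><\<^sub>k (q\<^sup>2\<^sup>l T - 1)\<close>, by splitting off the last factor.\<close>

fun gauss_coeff :: "nat \<Rightarrow> nat \<Rightarrow> 'k" where
  "gauss_coeff 0 s = (if s = 0 then 1 else 0)"
| "gauss_coeff (Suc k) 0 = - gauss_coeff k 0"
| "gauss_coeff (Suc k) (Suc s) = (q ^ 2) ^ k * gauss_coeff k s - gauss_coeff k (Suc s)"

lemma gauss_coeff_0: "gauss_coeff k 0 = (- 1) ^ k"
  by (induction k) simp_all

lemma gauss_coeff_eq_0: "k < s \<Longrightarrow> gauss_coeff k s = 0"
  by (induction k s rule: gauss_coeff.induct) simp_all

text \<open>Splitting off the first factor \<open>T - 1\<close> instead leaves the product for \<open>k\<close> with \<open>q\<^sup>2 T\<close> in place of \<open>T\<close>.\<close>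

lemma gauss_coeff_other_recursion:
  "gauss_coeff (Suc k) (Suc s) = (q ^ 2) ^ s * gauss_coeff k s - (q ^ 2) ^ Suc s * gauss_coeff k (Suc s)"
proof (induction k arbitrary: s)
  case 0
  show ?case by simp
next
  case (Suc k)
  define w where "w = q ^ 2"
  show ?case
  proof (cases s)
    case 0
    have "gauss_coeff (Suc (Suc k)) (Suc 0) = w ^ Suc k * gauss_coeff (Suc k) 0 - gauss_coeff (Suc k) (Suc 0)"
      by (simp add: w_def)
    also have "gauss_coeff (Suc k) (Suc 0) = gauss_coeff k 0 - w * gauss_coeff k (Suc 0)"
      using Suc[of 0] by (simp add: w_def)
    finally show ?thesis
      unfolding 0 by (simp add: algebra_simps flip: w_def)
  next
    case (Suc r)
    have "gauss_coeff (Suc (Suc k)) (Suc s) = w ^ Suc k * gauss_coeff (Suc k) s - gauss_coeff (Suc k) (Suc s)"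
      by (simp add: w_def)
    also have "\<dots> = w ^ Suc k * (w ^ r * gauss_coeff k r - w ^ Suc r * gauss_coeff k (Suc r))
        - (w ^ Suc r * gauss_coeff k (Suc r) - w ^ Suc (Suc r) * gauss_coeff k (Suc (Suc r)))"
      unfolding w_def by (simp only: Suc Suc.IH)
    also have "\<dots> = w ^ s * gauss_coeff (Suc k) s - w ^ Suc s * gauss_coeff (Suc k) (Suc s)"
      unfolding Suc by (simp add: algebra_simps flip: w_def)
    finally show ?thesis by (simp only: w_def)
  qed
qed

text \<open>For \<open>k = p - 1\<close> the missing factor of the full product \<open>\<plusminus>(1 - T\<^sup>p)\<close> is \<open>q\<^sup>-\<^sup>2 T - 1\<close>, so the
  coefficients form a geometric progression. Comparing the two recursions gives its ratio.\<close>

lemma gauss_coeff_root_of_unity: "s < p \<Longrightarrow> gauss_coeff (p - 1) s = (- 1) ^ (p - 1) * (inverse q ^ 2) ^ s"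
proof (induction s)
  case 0
  show ?case by (simp add: gauss_coeff_0)
next
  case (Suc s)
  let ?w = "q ^ 2" and ?c = "gauss_coeff (p - 1)"
  have "?w ^ (p - 1) * ?w = ?w ^ p"
    using p_ge_2 by (simp flip: power_Suc2)
  then have w: "?w ^ (p - 1) * ?w = 1"
    by (simp flip: power_mult)
  have cancel: "(1 - w * X) * (w * v - u) = 0" if "W * u - v = X * u - w * X * v" "W * w = 1" for w W X u v :: 'k
    using that by algebra
  have "?w ^ (p - 1) * ?c s - ?c (Suc s) = ?w ^ s * ?c s - ?w * ?w ^ s * ?c (Suc s)"
    using gauss_coeff_other_recursion[of "p - 1" s] by simp
  from cancel[OF this w] have "(1 - ?w ^ Suc s) * (?w * ?c (Suc s) - ?c s) = 0"
    by simp
  moreover have "?w ^ Suc s \<noteq> 1"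
    using q_power_neq_1[of "2 * Suc s"] Suc.prems by (simp only: power_mult) simp
  ultimately have "?w * ?c (Suc s) = ?c s" by simp
  then have "?c (Suc s) = inverse q ^ 2 * ?c s"
    by (simp add: power_inverse field_simps)
  then show ?case using Suc by simp
qed

end

context restricted_sl2
begin

section \<open>The integral on Verma modules\<close>

context
  fixes a :: 'k
  assumes a: "a \<in> roots"
begin

lemma verma_ad_E:
  assumes "Suc k < p"
  shows "verma a (ad E y) i (Suc k)
    = (eps a i * verma a y (Suc i) (Suc k) - verma a y i k * eps a k) * (inverse a * q ^ (2 * Suc k))"
  using assms
  by (simp only: ad_generators verma_diff[OF a] verma_mult_Kinv[OF a] mult.assoc[of E] verma_mult_E[OF a])
     (simp add: verma_E[OF a] verma_mult_Kinv[OF a] algebra_simps)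

text \<open>Each \<open>ad E\<close> pushes the diagonal of \<open>y\<close> one place further above the main diagonal. Apart from the
  raising coefficients of \<open>E\<close> and powers of \<open>q\<close> and \<open>a\<close>, the entries follow the recursion
  \<open>V\<^sub>i \<mapsto> q\<^sup>2\<^sup>k V\<^sub>i\<^sub>+\<^sub>1 - V\<^sub>i\<close>, that is, the Gauss product in the shift operator.\<close>

lemma verma_ad_E_power:
  "i + k < p \<Longrightarrow> verma a ((ad E ^^ k) y) i (i + k)
    = (\<Prod>l=i..<i + k. eps a l) * (inverse a ^ k * (q ^ (2 * k * i) * q ^ (k * Suc k)))
      * (\<Sum>s\<le>k. gauss_coeff k s * verma a y (i + s) (i + s))"
proof (induction k arbitrary: i)
  case 0
  show ?case by simp
next
  case (Suc k)
  define V where "V i = (\<Sum>s\<le>k. gauss_coeff k s * verma a y (i + s) (i + s))" for i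
  have gauss: "(\<Sum>s\<le>Suc k. gauss_coeff (Suc k) s * verma a y (i + s) (i + s)) = q ^ (2 * k) * V (Suc i) - V i"
  proof -
    have "V i = gauss_coeff k 0 * verma a y i i + (\<Sum>s\<le>k. gauss_coeff k (Suc s) * verma a y (i + Suc s) (i + Suc s))"
      using sum.atMost_Suc_shift[of "\<lambda>s. gauss_coeff k s * verma a y (i + s) (i + s)" k]
        sum.atMost_Suc[of "\<lambda>s. gauss_coeff k s * verma a y (i + s) (i + s)" k]
      by (simp add: V_def gauss_coeff_eq_0)
    then show ?thesis
      unfolding sum.atMost_Suc_shift
      by (simp add: V_def sum_distrib_left sum_subtractf left_diff_distrib power_mult mult.assoc)
  qed
  define Q where "Q = (\<Prod>l=i..<Suc (i + k). eps a l)"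
  define Z where "Z = (ad E ^^ k) y"
  have Q: "eps a i * (\<Prod>l=Suc i..<Suc (i + k). eps a l) = Q" "(\<Prod>l=i..<i + k. eps a l) * eps a (i + k) = Q"
    by (simp_all add: Q_def prod.atLeast_Suc_lessThan)
  have IH: "verma a Z (Suc i) (Suc (i + k)) = (\<Prod>l=Suc i..<Suc (i + k). eps a l)
        * (inverse a ^ k * (q ^ (2 * k * Suc i) * q ^ (k * Suc k))) * V (Suc i)"
    "verma a Z i (i + k) = (\<Prod>l=i..<i + k. eps a l)
        * (inverse a ^ k * (q ^ (2 * k * i) * q ^ (k * Suc k))) * V i"
    using Suc.IH[of "Suc i"] Suc.IH[of i] Suc.prems by (simp_all add: Z_def V_def)
  have e1: "q ^ (2 * k * Suc i) = q ^ (2 * k * i) * q ^ (2 * k)"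
    and e2: "q ^ (2 * Suc k * i) * q ^ (Suc k * Suc (Suc k)) = q ^ (2 * k * i) * q ^ (k * Suc k) * q ^ (2 * Suc (i + k))"
    unfolding power_add[symmetric] by (rule arg_cong[of _ _ "(^) q"], simp add: algebra_simps)+
  have "verma a ((ad E ^^ Suc k) y) i (i + Suc k)
      = (eps a i * verma a Z (Suc i) (Suc (i + k)) - verma a Z i (i + k) * eps a (i + k))
        * (inverse a * q ^ (2 * Suc (i + k)))"
    using verma_ad_E[of "i + k" Z i] Suc.prems by (simp add: Z_def)
  also have "eps a i * verma a Z (Suc i) (Suc (i + k))
      = Q * (inverse a ^ k * (q ^ (2 * k * i) * q ^ (2 * k) * q ^ (k * Suc k))) * V (Suc i)"
    unfolding IH Q(1)[symmetric] e1 by (simp only: mult_ac)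
  also have "verma a Z i (i + k) * eps a (i + k)
      = Q * (inverse a ^ k * (q ^ (2 * k * i) * q ^ (k * Suc k))) * V i"
    unfolding IH Q(2)[symmetric] by (simp only: mult_ac)
  also have "(Q * (inverse a ^ k * (q ^ (2 * k * i) * q ^ (2 * k) * q ^ (k * Suc k))) * V (Suc i)
        - Q * (inverse a ^ k * (q ^ (2 * k * i) * q ^ (k * Suc k))) * V i) * (inverse a * q ^ (2 * Suc (i + k)))
      = Q * (inverse a ^ Suc k * (q ^ (2 * k * i) * q ^ (k * Suc k) * q ^ (2 * Suc (i + k))))
        * (q ^ (2 * k) * V (Suc i) - V i)"
    unfolding power_Suc[of "inverse a"] by (simp only: left_diff_distrib right_diff_distrib mult_ac)
  finally show ?case
    unfolding gauss e2 by (simp add: Q_def)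
qed

text \<open>In the last column the second term of \<open>ad F\<close> disappears because \<open>F\<close> kills the lowest vector.\<close>

lemma verma_ad_F_power:
  "k < p \<Longrightarrow> verma a ((ad F ^^ k) y) k (p - 1) = verma a y 0 (p - 1)"
proof (induction k)
  case (Suc k)
  have "verma a (z * F) i (p - 1) = 0" for z i
    using verma_mult_F[OF a, of z i "p - 1"] p_ge_2 by (simp add: verma_out[OF a])
  with Suc show ?case
    by (simp add: ad_generators verma_diff[OF a] verma_F[OF a])
qed simp

text \<open>The scalar by which \<open>E\<^sup>p\<^sup>-\<^sup>1 F\<^sup>p\<^sup>-\<^sup>1\<close> acts on the highest weight vector.\<close>

definition verma_eps_product :: 'k where
  "verma_eps_product = (\<Prod>l<p - 1. eps a l)"

definition verma_integral_const :: 'k where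
  "verma_integral_const = of_nat (2 * p) * inverse a ^ (p - 1) * verma_eps_product"

text \<open>Commuting with \<open>K\<close> makes the matrix diagonal, commuting with \<open>F\<close> makes the diagonal constant, and
  the corner entry \<open>(p-1, p-1)\<close> is reached from the diagonal of \<open>y\<close> by \<open>p - 1\<close> steps \<open>ad E\<close> up to
  the entry \<open>(0, p-1)\<close> and \<open>p - 1\<close> steps \<open>ad F\<close> down the last column.\<close>

lemma verma_ad_integral:
  assumes "i < p" "k < p"
  shows "verma a (ad integral_element y) i k
    = (if i = k then verma_integral_const * (\<Sum>s<p. inverse q ^ (2 * s) * verma a y s s) else 0)"
proof -
  define N where "N = ad integral_element y"
  define D where "D = (\<Sum>j=0..2 * p - 1. (ad K ^^ j) y)"
  have "verma a ((ad K ^^ j) y) s s = verma a y s s" for j s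
    by (induction j)
       (use roots_nonzero[OF a] in \<open>simp_all add: ad_generators verma_mult_Kinv[OF a] verma_K[OF a] power_inverse field_simps\<close>)
  then have D: "verma a D s s = of_nat (2 * p) * verma a y s s" for s
    using p_ge_2 by (simp add: D_def verma_sum[OF a])
  have "N = (ad F ^^ (p - 1)) ((ad E ^^ (p - 1)) D)"
    by (simp add: N_def integral_element_def ad_mult ad_power ad_sum_left D_def)
  then have "verma a N (p - 1) (p - 1) = verma a ((ad E ^^ (p - 1)) D) 0 (p - 1)"
    using verma_ad_F_power[of "p - 1"] p_ge_2 by simp
  also have "\<dots> = verma_eps_product * (inverse a ^ (p - 1) * q ^ ((p - 1) * Suc (p - 1)))
      * (\<Sum>s\<le>p - 1. gauss_coeff (p - 1) s * verma a D s s)"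
    using verma_ad_E_power[of 0 "p - 1" D] p_ge_2 by (simp add: verma_eps_product_def atLeast0LessThan)
  also have "q ^ ((p - 1) * Suc (p - 1)) = (- 1) ^ (p - 1)"
    using p_ge_2 by (simp add: mult.commute power_mult)
  also have "(\<Sum>s\<le>p - 1. gauss_coeff (p - 1) s * verma a D s s)
      = (\<Sum>s<p. (- 1) ^ (p - 1) * (of_nat (2 * p) * (inverse q ^ (2 * s) * verma a y s s)))"
  proof (rule sum.cong)
    fix s assume "s \<in> {..<p}"
    then have "gauss_coeff (p - 1) s = (- 1) ^ (p - 1) * inverse q ^ (2 * s)"
      using gauss_coeff_root_of_unity[of s] by (simp add: power_mult)
    then show "gauss_coeff (p - 1) s * verma a D s s
        = (- 1) ^ (p - 1) * (of_nat (2 * p) * (inverse q ^ (2 * s) * verma a y s s))"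
      by (simp only: D mult_ac)
  qed (use p_ge_2 in auto)
  also have "\<dots> = (- 1) ^ (p - 1) * (of_nat (2 * p) * (\<Sum>s<p. inverse q ^ (2 * s) * verma a y s s))"
    by (simp only: sum_distrib_left)
  finally have corner: "verma a N (p - 1) (p - 1)
      = verma_integral_const * (\<Sum>s<p. inverse q ^ (2 * s) * verma a y s s)"
    by (simp add: verma_integral_const_def mult_ac flip: power_mult_distrib)
  have K: "K * N = N * K" and F: "F * N = N * F"
    unfolding N_def by (rule ad_integral_commutes)+
  have step: "verma a N s s = verma a N (Suc s) (Suc s)" if "Suc s < p" for s
    using verma_F[OF a, of N "Suc s" s] verma_mult_F[OF a, of N "Suc s" s] that F by simp
  have "verma a N (p - 1 - s) (p - 1 - s) = verma a N (p - 1) (p - 1)" if "s < p" for s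
    using that
  proof (induction s)
    case (Suc s)
    then show ?case using step[of "p - 1 - Suc s"] by (simp add: Suc_diff_Suc)
  qed simp
  from this[of "p - 1 - i"] have diag: "verma a N i i = verma a N (p - 1) (p - 1)"
    using assms by simp
  have off: "verma a N i k = 0" if "i \<noteq> k"
  proof -
    have "a * inverse q ^ (2 * i) * verma a N i k = a * inverse q ^ (2 * k) * verma a N i k"
      by (simp only: verma_K[OF a, of N i k, symmetric] verma_mult_K[OF a, of N i k, symmetric] K)
    moreover have "inverse q ^ (2 * i) \<noteq> inverse q ^ (2 * k)"
      using inj_onD[OF inj_on_q_power, of "2 * i" "2 * k"] assms that by (auto simp: power_inverse)
    ultimately show ?thesis
      using roots_nonzero[OF a] by simp
  qed
  show ?thesis
    using diag off corner by (auto simp: N_def)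
qed

text \<open>\<open>F\<^sup>p\<^sup>-\<^sup>1\<^sup>-\<^sup>k\<close> lowers \<open>F\<^sup>k v\<close> to the lowest vector, and \<open>E\<^sup>p\<^sup>-\<^sup>1\<close> sees only the lowest vector.\<close>

lemma verma_matrix_unit:
  assumes "i < p" "k < p" "i' < p" "k' < p"
  shows "verma a (F ^ i * E ^ (p - 1) * F ^ (p - 1 - k)) i' k'
    = (if i' = i \<and> k' = k then verma_eps_product else 0)"
proof -
  have E_power: "l + n < p \<Longrightarrow> coord a (E ^ n * F ^ m) l 0
      = (\<Prod>t=l..<l + n. eps a t) * coord a (F ^ m) (l + n) 0" for l n m
  proof (induction n arbitrary: l)
    case (Suc n)
    then show ?case
      by (simp add: mult.assoc coord_E[OF a] prod.atLeast_Suc_lessThan)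
  qed simp
  have F_power: "coord a (F ^ m) l 0 = (if l = m \<and> m < p then 1 else 0)" for m l
    using coord_F_power[OF a, of m 1 l 0] by (auto simp: coord_one[OF a])
  have E_power_out: "coord a (E ^ n * F ^ m) l 0 = 0" if "p \<le> l + n" for l n m
    using that
  proof (induction n arbitrary: l)
    case 0
    then show ?case by (simp add: coord_out[OF a])
  next
    case (Suc n)
    then show ?case by (simp add: mult.assoc coord_E[OF a])
  qed
  have "verma a (F ^ i * E ^ (p - 1) * F ^ (p - 1 - k)) i' k'
      = coord a (F ^ i * (E ^ (p - 1) * F ^ (p - 1 - k + k'))) i' 0"
    by (simp add: verma_def mult.assoc power_add)
  also have "\<dots> = (if i \<le> i' then coord a (E ^ (p - 1) * F ^ (p - 1 - k + k')) (i' - i) 0 else 0)"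
    using assms by (simp add: coord_F_power[OF a])
  also have "\<dots> = (if i' = i \<and> k' = k then verma_eps_product else 0)"
  proof (cases "i' = i")
    case True
    have "p - 1 = p - 1 - k + k' \<and> p - 1 - k + k' < p \<longleftrightarrow> k' = k"
      using assms by auto
    then show ?thesis
      using True E_power[of 0 "p - 1" "p - 1 - k + k'"] p_ge_2
      by (simp add: F_power verma_eps_product_def atLeast0LessThan)
  next
    case False
    then show ?thesis
      using E_power_out[of "i' - i" "p - 1"] assms by auto
  qed
  finally show ?thesis .
qed

text \<open>The orthogonality relation behind the theorem, read off from the entries of \<open>ad \<Lambda> y\<close> for a matrix
  unit \<open>y\<close>.\<close>

lemma sweedler_integral_verma:
  assumes nz: "verma_eps_product \<noteq> 0" and ik: "i < p" "k < p"
  shows "sweedler integral_element (\<lambda>b c. verma a b i i * verma a (antipode c) k k)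
    = (if i = k then verma_integral_const * inverse q ^ (2 * i) else 0)"
proof -
  let ?S = antipode
  define y where "y = F ^ i * E ^ (p - 1) * F ^ (p - 1 - k)"
  have unit: "verma a y l m = (if l = i \<and> m = k then verma_eps_product else 0)" if "l < p" "m < p" for l m
    unfolding y_def by (rule verma_matrix_unit[OF ik that])
  have entry: "verma a (b * y * ?S c) i k = verma_eps_product * (verma a b i i * verma a (?S c) k k)" for b c
  proof -
    have "(\<Sum>l<p. verma a b i l * verma a y l m) = (if m = k then verma a b i i * verma_eps_product else 0)"
      if m: "m < p" for m
    proof -
      have "(\<Sum>l<p. verma a b i l * verma a y l m)
          = (\<Sum>l<p. if l = i then (if m = k then verma a b i i * verma_eps_product else 0) else 0)"
        using m by (intro sum.cong refl) (simp add: unit)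
      then show ?thesis using ik by (simp add: sum.delta)
    qed
    then have "verma a (b * y * ?S c) i k
        = (\<Sum>m<p. if m = k then verma a b i i * verma_eps_product * verma a (?S c) k k else 0)"
      unfolding verma_mult[OF a, of "b * y"] verma_mult[OF a, of b y]
      by (intro sum.cong refl) simp
    then show ?thesis
      using ik by (simp add: sum.delta mult_ac)
  qed
  have "verma_eps_product * sweedler integral_element (\<lambda>b c. verma a b i i * verma a (?S c) k k)
      = verma a (ad integral_element y) i k"
    unfolding ad_def
    by (subst (1 2) sweedler_additive) (simp_all add: distrib_left entry verma_add[OF a])
  also have "\<dots> = (if i = k then verma_integral_const * (\<Sum>s<p. inverse q ^ (2 * s) * verma a y s s) else 0)"
    by (rule verma_ad_integral) (use ik in auto)
  also have "(\<Sum>s<p. inverse q ^ (2 * s) * verma a y s s)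
      = (\<Sum>s<p. if s = i then (if i = k then inverse q ^ (2 * i) * verma_eps_product else 0) else 0)"
    using ik by (intro sum.cong refl) (auto simp: unit)
  finally show ?thesis
    using nz ik by (auto simp: sum.delta)
qed

text \<open>The commutator applies the orthogonality relation twice: once as the scalar by which
  \<open>ad \<Lambda>\<close> acts, once for the remaining copy of \<open>\<Lambda>\<close>. The powers \<open>q\<^sup>-\<^sup>2\<^sup>s\<close>, \<open>q\<^sup>4\<^sup>s\<close>, \<open>q\<^sup>-\<^sup>2\<^sup>s\<close> cancel, so each
  of the \<open>p\<close> diagonal entries contributes the same amount.\<close>

lemma verma_trace_commutator:
  "(\<Sum>i<p. verma a (commutator comul antipode (K ^ 2) integral_element integral_element) i i)
     = of_nat p * (verma_integral_const * inverse a) ^ 2"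
proof -
  let ?L = integral_element and ?S = antipode
  have conj: "verma a (K * b * Kinv) s s = verma a b s s" for b s
    using roots_nonzero[OF a]
    by (simp add: verma_mult_Kinv[OF a] verma_K[OF a] power_inverse field_simps)
  have entry: "verma a (ad ?L (K * b * Kinv) * (Kinv * ?S c * Kinv)) i i
      = (\<Sum>s<p. verma_integral_const * inverse q ^ (2 * s) * (inverse a * q ^ (2 * i)) ^ 2
          * (verma a b s s * verma a (?S c) i i))" if i: "i < p" for b c i
  proof -
    have "verma a (ad ?L (K * b * Kinv) * (Kinv * ?S c * Kinv)) i i
        = (\<Sum>l<p. if l = i then verma a (ad ?L (K * b * Kinv)) i i * verma a (Kinv * ?S c * Kinv) i i else 0)"
      unfolding verma_mult[OF a, of "ad ?L _"]
      using i by (intro sum.cong refl) (auto simp: verma_ad_integral)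
    also have "\<dots> = verma_integral_const * (\<Sum>s<p. inverse q ^ (2 * s) * verma a b s s)
        * ((inverse a * q ^ (2 * i)) ^ 2 * verma a (?S c) i i)"
      using i by (simp add: sum.delta verma_ad_integral conj conj[unfolded mult.assoc] verma_mult_Kinv[OF a] verma_Kinv[OF a]
          power2_eq_square mult.assoc)
    finally show ?thesis
      by (simp add: sum_distrib_left sum_distrib_right mult_ac)
  qed
  have pull: "sweedler x (\<lambda>b c. r * B b c) = r * sweedler x B" for r :: 'k and x B
    by (rule sweedler_mult_left[symmetric])
  have "(\<Sum>i<p. verma a (commutator comul antipode (K ^ 2) ?L ?L) i i)
      = (\<Sum>i<p. \<Sum>s<p. verma_integral_const * inverse q ^ (2 * s) * (inverse a * q ^ (2 * i)) ^ 2
          * sweedler ?L (\<lambda>b c. verma a b s s * verma a (?S c) i i))"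
  proof (intro sum.cong refl)
    fix i assume i: "i \<in> {..<p}"
    have "verma a (commutator comul antipode (K ^ 2) ?L ?L) i i
        = sweedler ?L (\<lambda>b c. verma a (ad ?L (K * b * Kinv) * (Kinv * ?S c * Kinv)) i i)"
      unfolding commutator_eq_ad
      by (rule sweedler_additive) (simp add: verma_add[OF a])
    then show "verma a (commutator comul antipode (K ^ 2) ?L ?L) i i
        = (\<Sum>s<p. verma_integral_const * inverse q ^ (2 * s) * (inverse a * q ^ (2 * i)) ^ 2
          * sweedler ?L (\<lambda>b c. verma a b s s * verma a (?S c) i i))"
      using i by (simp add: entry sweedler_sum pull)
  qed
  also have "\<dots> = of_nat p * (verma_integral_const * inverse a) ^ 2"
  proof (cases "verma_eps_product = 0")
    case True
    then show ?thesis by (simp add: verma_integral_const_def)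
  next
    case False
    have unit: "inverse q ^ (2 * i) * q ^ (2 * i) = 1" for i
      by (simp flip: power_mult_distrib)
    have "(\<Sum>s<p. verma_integral_const * inverse q ^ (2 * s) * (inverse a * q ^ (2 * i)) ^ 2
          * sweedler ?L (\<lambda>b c. verma a b s s * verma a (?S c) i i)) = (verma_integral_const * inverse a) ^ 2"
      if i: "i < p" for i
    proof -
      have "(\<Sum>s<p. verma_integral_const * inverse q ^ (2 * s) * (inverse a * q ^ (2 * i)) ^ 2
          * sweedler ?L (\<lambda>b c. verma a b s s * verma a (?S c) i i))
        = (\<Sum>s<p. if s = i then verma_integral_const * inverse q ^ (2 * i) * (inverse a * q ^ (2 * i)) ^ 2
          * (verma_integral_const * inverse q ^ (2 * i)) else 0)"
        using i by (intro sum.cong refl) (auto simp: sweedler_integral_verma[OF False])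
      also have "\<dots> = (verma_integral_const * inverse a) ^ 2 * (inverse q ^ (2 * i) * q ^ (2 * i)) ^ 2"
        using i by (simp add: sum.delta power2_eq_square mult_ac)
      finally show ?thesis by (simp only: unit) simp
    qed
    then show ?thesis by simp
  qed
  finally show ?thesis .
qed

end

section \<open>The two Steinberg weights\<close>

text \<open>Each \<open>a\<^sup>2\<close> is \<open>q\<^sup>2\<^sup>l\<close> with \<open>l < p\<close>. For \<open>l < p - 1\<close> the factor \<open>eps a l\<close> vanishes, and \<open>l = p - 1\<close> means
  \<open>a\<^sup>2 = q\<^sup>-\<^sup>2\<close>.\<close>

lemma verma_eps_product_eq_0:
  assumes a: "a \<in> roots" "a \<noteq> inverse q" "a \<noteq> - inverse q"
  shows "verma_eps_product a = 0"
proof -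
  obtain m where m: "a = q ^ m" using a by (auto simp: roots_eq)
  define l where "l = m mod p"
  have l: "l < p" using p_ge_2 by (simp add: l_def)
  have a_sq: "a * a = q ^ l * q ^ l"
  proof -
    have "a * a = q ^ (2 * p * (m div p) + 2 * l)"
      unfolding m power_add[symmetric] l_def
      by (rule arg_cong[of _ _ "(^) q"]) (metis mult.assoc mult_2 mult_div_mod_eq distrib_left)
    also have "\<dots> = q ^ (2 * l)"
      unfolding power_add power_mult[of q "2 * p"] q_2p by simp
    finally show ?thesis by (simp add: mult_2 power_add)
  qed
  have "l \<noteq> p - 1"
  proof
    assume "l = p - 1"
    then have q_l: "q ^ l * q = - 1"
      using p_ge_2 by (simp flip: power_Suc2)
    have "(a * q) ^ 2 = (a * a) * (q * q)"
      by (simp only: power2_eq_square mult_ac)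
    also have "\<dots> = (q ^ l * q) * (q ^ l * q)"
      unfolding a_sq by (simp only: mult_ac)
    finally have "(a * q) ^ 2 = 1"
      unfolding q_l by simp
    then have "a * q = 1 \<or> a * q = - 1" by (simp add: power2_eq_1_iff)
    then show False using a by (auto simp: field_simps)
  qed
  then have "l < p - 1" using l by simp
  moreover have "eps a l = 0"
    using a_sq roots_nonzero[OF a(1)] by (simp add: eps_def power_inverse field_simps)
  ultimately show ?thesis
    by (auto simp: verma_eps_product_def[OF a(1)])
qed

text \<open>For \<open>a = \<plusminus>q\<^sup>-\<^sup>1\<close> each \<open>eps a l\<close> is \<open>\<mp>[l+1]\<^sup>2\<close>; the square removes all signs.\<close>

lemma verma_integral_const_steinberg:
  assumes t: "t * t = (1 :: 'k)" and a: "a = t * inverse q" and roots: "a \<in> roots"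
  shows "(verma_integral_const a * inverse a) ^ 2 = 4 * of_nat p ^ 2 * q_fact q (p - 1) ^ 4"
proof -
  have t0: "t \<noteq> 0" using t by auto
  have inv_a: "inverse a = t * q"
    using t t0 by (simp add: a field_simps)
  have "eps a l = - t * q_int q (Suc l) ^ 2" for l
  proof -
    have "a * inverse q ^ l - inverse a * q ^ l = - t * (q ^ Suc l - inverse q ^ Suc l)"
      unfolding inv_a by (simp add: a algebra_simps)
    then show ?thesis
      by (simp only: eps_def q_int_def) (simp add: power2_eq_square)
  qed
  then have "verma_eps_product a = (\<Prod>l<p - 1. - t * q_int q (Suc l) ^ 2)"
    by (simp add: verma_eps_product_def[OF roots])
  also have "\<dots> = (- t) ^ (p - 1) * (\<Prod>l<p - 1. q_int q (Suc l)) ^ 2"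
    by (simp only: prod.distrib prod_constant card_lessThan prod_power_distrib)
  also have "(\<Prod>l<p - 1. q_int q (Suc l)) = q_fact q (p - 1)"
    unfolding q_fact_def
    by (rule prod.reindex_bij_witness[of _ "\<lambda>l. l - 1" Suc]) auto
  finally have prod: "verma_eps_product a = (- t) ^ (p - 1) * q_fact q (p - 1) ^ 2" .
  have "(verma_integral_const a * inverse a) ^ 2
      = 4 * of_nat p ^ 2 * q_fact q (p - 1) ^ 4 * ((- t) ^ (p - 1) * (t * q) ^ (p - 1) * (t * q)) ^ 2"
    unfolding verma_integral_const_def[OF roots] prod inv_a
    by (simp add: power_mult_distrib mult_ac flip: power_mult)
  also have "(- t) ^ (p - 1) * (t * q) ^ (p - 1) * (t * q) = (- t * (t * q)) ^ (p - 1) * (t * q)"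
    by (simp only: power_mult_distrib)
  also have "- t * (t * q) = - q"
    using t by (simp flip: mult.assoc)
  also have "((- q) ^ (p - 1) * (t * q)) ^ 2 = ((- q) ^ (p - 1) * q) ^ 2 * (t * t)"
    by (simp add: power2_eq_square mult_ac)
  also have "\<dots> = 1"
  proof -
    have "((- q) ^ (p - 1) * q) ^ 2 = ((q ^ (p - 1)) * q) ^ 2"
      by (simp add: power_mult_distrib flip: power_mult)
    also have "q ^ (p - 1) * q = q ^ p"
      using p_ge_2 by (simp flip: power_Suc2)
    finally show ?thesis using t by simp
  qed
  finally show ?thesis by simp
qed

theorem regular_character_integral_commutator:
  assumes lam: "right_integral smul comul lam" "lam \<noteq> (\<lambda>_. 0)"
    and g: "distinguished_group_like smul comul lam g"
  shows "regular_character smul (commutator comul antipode g integral_element integral_element)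
    = 8 * of_nat p ^ 4 * q_fact q (p - 1) ^ 4"
proof -
  let ?c = "\<lambda>a. (verma_integral_const a * inverse a) ^ 2"
  have roots: "inverse q \<in> roots" "- inverse q \<in> roots"
    using roots_inverse[OF q_in_roots] by (simp_all add: roots_def)
  have distinct: "inverse q \<noteq> - inverse q"
    by simp
  have "regular_character smul (commutator comul antipode g integral_element integral_element)
      = of_nat p * (\<Sum>a\<in>roots. of_nat p * ?c a)"
    unfolding distinguished_group_like_eq[OF lam g] regular_character_verma
    by (simp add: verma_trace_commutator)
  also have "(\<Sum>a\<in>roots. of_nat p * ?c a) = (\<Sum>a\<in>{inverse q, - inverse q}. of_nat p * ?c a)"
    using roots verma_eps_product_eq_0
    by (intro sum.mono_neutral_right) (auto simp: verma_integral_const_def)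
  also have "\<dots> = of_nat p * ?c (inverse q) + of_nat p * ?c (- inverse q)"
    using distinct by simp
  also have "?c (inverse q) = 4 * of_nat p ^ 2 * q_fact q (p - 1) ^ 4"
    by (rule verma_integral_const_steinberg[of 1]) (use roots in auto)
  also have "?c (- inverse q) = 4 * of_nat p ^ 2 * q_fact q (p - 1) ^ 4"
    by (rule verma_integral_const_steinberg[of "- 1"]) (use roots in auto)
  finally show ?thesis
    by (simp add: power4_eq_xxxx power2_eq_square mult_ac)
qed

end

theorem proposition8p2:
  fixes p :: nat
    and q :: "'k::field_char_0"
    and smul :: "'k \<Rightarrow> 'u::ring_1 \<Rightarrow> 'u"
    and comul :: "'u \<Rightarrow> ('u \<times> 'u) list"
    and counit :: "'u \<Rightarrow> 'k"
    and antipode :: "'u \<Rightarrow> 'u"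
    and E F K g \<Lambda> :: 'u
    and lam :: "'u \<Rightarrow> 'k"
  assumes "p \<ge> 2"
    and "primitive_root_of_unity (2 * p) q"
    and "restricted_quantum_group smul comul counit antipode p q E F K"
    and "right_integral smul comul lam" and "lam \<noteq> (\<lambda>_. 0)"
    and "distinguished_group_like smul comul lam g"
    and "\<Lambda> = F ^ (p - 1) * E ^ (p - 1) * (\<Sum>j=0..2 * p - 1. K ^ j)"
  shows "regular_character smul (commutator comul antipode g \<Lambda> \<Lambda>)
           = 8 * of_nat p ^ 4 * q_fact q (p - 1) ^ 4"
proof -
  interpret restricted_sl2 smul comul counit antipode p q E F K
    using assms(1-3) by (simp add: restricted_sl2_def even_root_of_unity_def)
  have "\<Lambda> = integral_element"
    using assms(7) by (simp only: integral_element_def)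
  then show ?thesis
    using regular_character_integral_commutator[OF assms(4-6)] by simp
qed

end
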